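(* Let $\mathbb K$ be a number field and let $\alpha\in\overline{\mathbb Q}^*$ be such that $[\mathbb K(\alpha):\mathbb Q]=d\ge 1$. For any $\varepsilon>0$ and any integer $\delta\ge 1$, there exists a constant $c=c(\varepsilon,\alpha,\delta,\mathbb K)>0$ such that for all $H\ge 1$ we have $$\left\vert P(e^{\alpha})\right\vert > \frac{c}{H^{\psi(d,\delta,\lambda)+\varepsilon}}$$ for every polynomial $P\in\mathcal O_{\mathbb K}[X]\setminus\{0\}$ of degree $\le\delta$ and height $H(P)\le H$, where $\psi$ and $\lambda=\lambda(d,\delta)$ are as defined in the context.
   Context: The field $\overline{\mathbb Q}$ of algebraic numbers is embedded in $\mathbb C$ (so number fields are subfields of $\mathbb C$), and $\overline{\mathbb Q}^*=\overline{\mathbb Q}\setminus\{0\}$. $\mathcal O_{\mathbb K}$ is the ring of integers of $\mathbb K$. The house of an algebraic number $\beta$ is the maximum of the moduli of $\beta$ and of all its Galois conjugates over $\mathbb Q$. For $P(X)=\sum_j a_jX^j\in\overline{\mathbb Q}[X]$, the height $H(P)$ is the maximum over $j$ of the houses of the coefficients $a_j$. For integers $d,\delta,p\ge 1$ with $p\ge\delta d$, define $$\psi(d,\delta,p):=\frac{\delta d^2(p-\delta+1)}{p-\delta d+1}+d(p-\delta+1)-1.$$ For $d\ge 2$, put $p_1:=\delta d-1+\lfloor\delta\sqrt{d^2-d}\rfloor$ and $p_2:=p_1+1$ (both are $\ge\delta d$), and define $\lambda:=p_1$ if $\psi(d,\delta,p_1)\le\psi(d,\delta,p_2)$, and $\lambda:=p_2$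 if $\psi(d,\delta,p_2)<\psi(d,\delta,p_1)$. For $d=1$, put $\lambda:=\delta$. Thus $\lambda$ depends on $d$ and $\delta$. *)

theory Defs
  imports
    "HOL-Analysis.Analysis"
    "HOL-Computational_Algebra.Computational_Algebra"
    "HOL-Algebra.Generated_Fields"
    "HOL-Algebra.Algebraic_Closure_Type"
begin

text \<open>
  A structure with explicit carrier, so that the locale-based notions of subfield, generated
  field and dimension over a subfield apply to sets of complex numbers.
\<close>

abbreviation complex_field :: "complex ring" where
  "complex_field \<equiv> ring_of_type_algebra"

definition number_field :: "complex set \<Rightarrow> bool" where
  "number_field K \<longleftrightarrow>
     subfield K complex_field \<and> ring.finite_dimension complex_field \<rat> K"

definition adjoin :: "complex set \<Rightarrow> complex \<Rightarrow> complex set" where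
  "adjoin K \<alpha> = generate_field complex_field (insert \<alpha> K)"

text \<open>
  \<open>has_degree_over_rat L d\<close> means [L : Q] = d; in particular the degree is finite.
\<close>

definition has_degree_over_rat :: "complex set \<Rightarrow> nat \<Rightarrow> bool" where
  "has_degree_over_rat L d \<longleftrightarrow> ring.dimension complex_field d \<rat> L"

definition ring_of_integers :: "complex set \<Rightarrow> complex set" where
  "ring_of_integers K = {x \<in> K. algebraic_int x}"

text \<open>
  The complex roots of the irreducible rational polynomial that vanishes at \<open>\<beta>\<close>. That
  polynomial is unique up to a nonzero rational factor; \<open>\<beta>\<close> itself is among the roots. For
  transcendental \<open>\<beta>\<close> the set is empty, and then the house below is meaningless.
\<close>

definition conjugates :: "complex \<Rightarrow> complex set" where
  "conjugates \<beta> =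
     {\<gamma>. \<exists>p :: rat poly. Factorial_Ring.irreducible p \<and>
           poly (map_poly of_rat p) \<beta> = 0 \<and> poly (map_poly of_rat p) \<gamma> = 0}"

definition house :: "complex \<Rightarrow> real" where
  "house \<beta> = Max (norm ` conjugates \<beta>)"

definition height :: "complex poly \<Rightarrow> real" where
  "height P = Max ((\<lambda>j. house (Polynomial.coeff P j)) ` {..Polynomial.degree P})"

text \<open>Intended for \<open>d, \<delta>, p \<ge> 1\<close> with \<open>p \<ge> \<delta> d\<close>, where both differences are positive.\<close>

definition psi :: "nat \<Rightarrow> nat \<Rightarrow> nat \<Rightarrow> real" where
  "psi d \<delta> p =
     real \<delta> * (real d)\<^sup>2 * (real p - real \<delta> + 1) / (real p - real \<delta> * real d + 1)
       + real d * (real p - real \<delta> + 1) - 1"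

text \<open>
  Intended for \<open>d \<ge> 2\<close> and \<open>\<delta> \<ge> 1\<close>, where the truncating operations \<open>nat\<close> and subtraction on
  natural numbers are exact.
\<close>

definition psi_p1 :: "nat \<Rightarrow> nat \<Rightarrow> nat" where
  "psi_p1 d \<delta> = \<delta> * d - 1 + nat \<lfloor>real \<delta> * sqrt ((real d)\<^sup>2 - real d)\<rfloor>"

definition psi_p2 :: "nat \<Rightarrow> nat \<Rightarrow> nat" where
  "psi_p2 d \<delta> = psi_p1 d \<delta> + 1"

definition lam :: "nat \<Rightarrow> nat \<Rightarrow> nat" where
  "lam d \<delta> =
     (if d = 1 then \<delta>
      else if psi d \<delta> (psi_p1 d \<delta>) \<le> psi d \<delta> (psi_p2 d \<delta>) then psi_p1 d \<delta>
      else psi_p2 d \<delta>)"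

text \<open>The maximum defining the house is over a finite set containing \<open>\<beta>\<close>.\<close>

lemma irreducible_rat_poly_exists:
  fixes \<beta> :: complex
  assumes "algebraic \<beta>"
  shows "\<exists>p :: rat poly. Factorial_Ring.irreducible p \<and> poly (map_poly of_rat p) \<beta> = 0"
proof -
  obtain q :: "complex poly"
    where q: "\<And>i. Polynomial.coeff q i \<in> \<int>" "q \<noteq> 0" "poly q \<beta> = 0"
    using assms unfolding algebraic_def by blast
  have "\<forall>i. \<exists>r :: rat. of_rat r = Polynomial.coeff q i"
    by (metis q(1) Ints_cases of_rat_of_int_eq)
  then obtain g :: "nat \<Rightarrow> rat" where g: "\<And>i. of_rat (g i) = Polynomial.coeff q i"
    by metis
  define r where "r = Poly (map g [0..<Suc (Polynomial.degree q)])"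
  have "Polynomial.coeff r i = g i" for i
  proof (cases "i \<le> Polynomial.degree q")
    case True
    then show ?thesis by (simp add: r_def nth_default_def del: upt_Suc)
  next
    case False
    then have "of_rat (g i) = (0 :: complex)" by (simp add: g coeff_eq_0)
    with False show ?thesis by (simp add: r_def nth_default_def del: upt_Suc)
  qed
  then have rq: "map_poly of_rat r = q"
    by (intro poly_eqI) (simp add: coeff_map_poly g)
  have "r \<noteq> 0" using rq q(2) by auto
  have hom: "map_poly of_rat (a * b) = (map_poly of_rat a * map_poly of_rat b :: complex poly)"
    for a b
    by (intro poly_eqI) (simp add: coeff_map_poly coeff_mult of_rat_sum of_rat_mult)
  have "\<exists>p. Factorial_Ring.irreducible p \<and> poly (map_poly of_rat p) \<beta> = 0"
    if "s \<noteq> 0" "poly (map_poly of_rat s) \<beta> = 0" for s :: "rat poly"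
    using that
  proof (induction "Polynomial.degree s" arbitrary: s rule: less_induct)
    case less
    have nu: "\<not> is_unit s"
    proof
      assume "is_unit s"
      then obtain c where "s = [:c:]" "c \<noteq> 0"
        by (metis is_unit_poly_iff dvd_0_left_iff zero_neq_one)
      then show False using less.prems by (simp add: map_poly_pCons)
    qed
    show ?case
    proof (cases "Factorial_Ring.irreducible s")
      case True
      then show ?thesis using less.prems by blast
    next
      case False
      then obtain a b where ab: "s = a * b" "\<not> is_unit a" "\<not> is_unit b"
        using less.prems nu by (auto simp: Factorial_Ring.irreducible_def)
      then have nz: "a \<noteq> 0" "b \<noteq> 0" using less.prems by auto
      then have "Polynomial.degree a > 0" "Polynomial.degree b > 0"
        using ab by (auto simp: is_unit_iff_degree)
      then have "Polynomial.degree a < Polynomial.degree s"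
        "Polynomial.degree b < Polynomial.degree s"
        using nz ab by (simp_all add: degree_mult_eq)
      moreover have "poly (map_poly of_rat a) \<beta> = 0 \<or> poly (map_poly of_rat b) \<beta> = 0"
        using less.prems ab hom by simp
      ultimately show ?thesis using less.hyps nz by blast
    qed
  qed
  then show ?thesis using \<open>r \<noteq> 0\<close> rq q(3) by blast
qed

lemma self_in_conjugates: "algebraic \<beta> \<Longrightarrow> \<beta> \<in> conjugates \<beta>"
  using irreducible_rat_poly_exists unfolding conjugates_def by blast

lemma finite_conjugates: "finite (conjugates \<beta>)"
proof (cases "conjugates \<beta> = {}")
  case False
  then obtain p :: "rat poly"
    where p: "Factorial_Ring.irreducible p" "poly (map_poly of_rat p) \<beta> = 0"
    unfolding conjugates_def by blast
  have hom: "map_poly of_rat (a * b) = (map_poly of_rat a * map_poly of_rat b :: complex poly)"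
    for a b
    by (intro poly_eqI) (simp add: coeff_map_poly coeff_mult of_rat_sum of_rat_mult)
  have homa: "map_poly of_rat (a + b) = (map_poly of_rat a + map_poly of_rat b :: complex poly)"
    for a b
    by (intro poly_eqI) (simp add: coeff_map_poly of_rat_add)
  have "conjugates \<beta> \<subseteq> {\<gamma>. poly (map_poly of_rat p) \<gamma> = 0}"
  proof
    fix \<gamma> assume "\<gamma> \<in> conjugates \<beta>"
    then obtain q :: "rat poly" where q: "Factorial_Ring.irreducible q"
        "poly (map_poly of_rat q) \<beta> = 0" "poly (map_poly of_rat q) \<gamma> = 0"
      unfolding conjugates_def by blast
    have "q dvd p"
    proof (rule ccontr)
      assume "\<not> q dvd p"
      then have "Rings.coprime q p"
        using q(1) by (simp add: irreducible_imp_prime_elem_gcd prime_elem_imp_coprime)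
      then obtain u v where "u * q + v * p = 1"
        using bezout_coefficients_fst_snd[of q p]
        by (metis coprime_iff_gcd_eq_1)
      then have "map_poly of_rat u * map_poly of_rat q + map_poly of_rat v * map_poly of_rat p
          = (1 :: complex poly)"
        by (metis hom homa map_poly_1' of_rat_1)
      then have "poly (1 :: complex poly) \<beta> = 0"
        using p(2) q(2) by (metis add_0 mult_zero_right poly_add poly_mult)
      then show False by simp
    qed
    then show "\<gamma> \<in> {\<gamma>. poly (map_poly of_rat p) \<gamma> = 0}"
      using q(3) hom by (auto elim!: dvdE)
  qed
  moreover have "(map_poly of_rat p :: complex poly) \<noteq> 0"
  proof
    assume "(map_poly of_rat p :: complex poly) = 0"
    then have "of_rat (Polynomial.coeff p i) = (0 :: complex)" for i
      by (metis coeff_map_poly of_rat_0 coeff_0)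
    then have "p = 0" by (intro poly_eqI) simp
    with p(1) show False by simp
  qed
  ultimately show ?thesis using poly_roots_finite finite_subset by blast
qed simp

end

theory Submission
  imports Defs "Jordan_Normal_Form.Char_Poly"
begin

text \<open>
  The proof is Hermite's method with a determinant. Let \<open>m = p + 1 - \<delta>\<close>. The polynomials
  \<open>P, X P, \<dots>, X\<^bsup>m-1\<^esup> P\<close> are \<open>m\<close> independent linear forms in \<open>1, e\<^sup>\<alpha>, \<dots>, e\<^bsup>p \<alpha>\<^esup>\<close> which are all small when
  \<open>P(e\<^sup>\<alpha>)\<close> is small. Hermite's construction (\<open>hermite_num\<close>) gives, for each \<open>n\<close>, a family of \<open>p + 1\<close>
  independent vectors of integers of \<open>\<rat>(\<alpha>)\<close>, up to a denominator \<open>D\<^bsup>O(n)\<^esup>\<close>, that are almost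
  proportional to \<open>(1, e\<^sup>\<alpha>, \<dots>, e\<^bsup>p \<alpha>\<^esup>)\<close>: with \<open>N = (n - 1)!\<close> and up to factors \<open>C\<^sup>n\<close>, the factor of
  proportionality has size \<open>N\<^sup>p\<close> and the error has size \<open>1 / N\<close> (\<open>hermite_num_bounds\<close>). Their
  independence is \<open>hermite_num_nondegenerate\<close>.

  Evaluating the \<open>m\<close> forms at \<open>m\<close> suitable vectors gives a square matrix with nonzero determinant
  \<open>\<Delta>\<close> (\<open>exists_det_hermite_mat_nonzero\<close>). Up to an error of size \<open>H / N\<close> the matrix has rank one,
  so \<open>|\<Delta>|\<close> is at most \<open>N\<^sup>\<delta> H\<^bsup>m-1\<^esup> |P(e\<^sup>\<alpha>)| + (H / N)\<^sup>m\<close>. Since Hermite's construction commutes with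
  the embeddings \<open>\<sigma>\<close> of \<open>K(\<alpha>)\<close>, the same estimate, with \<open>e\<^bsup>\<sigma>(\<alpha>)\<^esup>\<close> in the place of \<open>e\<^sup>\<alpha>\<close>, bounds
  every conjugate of \<open>\<Delta>\<close> by \<open>N\<^sup>\<delta> H\<^sup>m\<close> (\<open>norm_det_hermite_mat_le\<close>). The norm of \<open>\<Delta>\<close> is a nonzero
  integer up to the denominator, and so (\<open>liouville_inequality\<close>)
  \<open>1 \<le> C\<^sup>n (N\<^sup>\<delta> H\<^bsup>m-1\<^esup> |P(e\<^sup>\<alpha>)| + (H / N)\<^sup>m) (N\<^sup>\<delta> H\<^sup>m)\<^bsup>d-1\<^esup>\<close>.

  The summand without \<open>P\<close> is \<open>H\<^bsup>m d\<^esup> / N\<^sup>\<mu>\<close> with \<open>\<mu> = p + 1 - \<delta> d\<close>, which is positive exactly because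
  \<open>p \<ge> \<delta> d\<close>. Choosing \<open>n\<close> least such that it is below \<open>1/2\<close> makes \<open>N\<close> about \<open>H\<^bsup>m d/\<mu>\<^esup>\<close>, the
  exponential factors are absorbed by \<open>H\<^bsup>\<epsilon>\<^esup>\<close> (\<open>optimise_parameter\<close>), and \<open>|P(e\<^sup>\<alpha>)|\<close> is at least a
  constant times \<open>N\<^bsup>-\<delta> d\<^esup> H\<^bsup>-(m d - 1)\<^esup>\<close>. The resulting exponent of \<open>1 / H\<close> is
  \<open>\<delta> d\<^sup>2 m / \<mu> + m d - 1\<close>, which is \<open>psi d \<delta> p\<close>. This works for every \<open>p \<ge> \<delta> d\<close>, in
  particular for \<open>lam d \<delta>\<close>.

  The embeddings are made explicit by a primitive element \<open>\<theta>\<close> of \<open>K(\<alpha>)\<close>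
  (\<open>adjoin_primitive_element\<close>), and the integrality of the norm rests on the fact that algebraic
  integers form a ring.
\<close>

section \<open>The ring of algebraic integers\<close>

text \<open>
  The hypothesis says that \<open>z\<close> is an eigenvalue of an integer matrix, with eigenvector \<open>v\<close>, and
  the characteristic polynomial of an integer matrix is a monic integer polynomial.
\<close>

lemma algebraic_int_if_int_matrix:
  fixes z :: complex and v :: "nat \<Rightarrow> complex" and A :: "nat \<Rightarrow> nat \<Rightarrow> int"
  assumes nz: "i0 < n" "v i0 \<noteq> 0"
    and eig: "\<And>i. i < n \<Longrightarrow> z * v i = (\<Sum>j<n. of_int (A i j) * v j)"
  shows "algebraic_int z"
proof -
  define M where "M = Matrix.mat n n (\<lambda>(i, j). A i j)"
  define V where "V = Matrix.vec n v"
  have M: "M \<in> carrier_mat n n" by (simp add: M_def)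
  let ?M = "map_mat (of_int :: int \<Rightarrow> complex) M"
  have "eigenvector ?M V z"
    unfolding eigenvector_def
  proof (intro conjI)
    show "V \<in> carrier_vec (dim_row ?M)" by (simp add: V_def M_def)
    have "vec_index V i0 \<noteq> 0" using nz by (simp add: V_def)
    then show "V \<noteq> 0\<^sub>v (dim_row ?M)" using nz by (auto simp: M_def)
    show "?M *\<^sub>v V = z \<cdot>\<^sub>v V"
      by (rule eq_vecI) (auto simp: M_def V_def eig scalar_prod_def lessThan_atLeast0)
  qed
  then have "eigenvalue ?M z" by (auto simp: eigenvalue_def)
  then have "poly (char_poly ?M) z = 0"
    using eigenvalue_root_char_poly[of ?M n z] M by simp
  then have r: "poly (map_poly of_int (char_poly M)) z = 0"
    using of_int_hom.char_poly_hom[OF M, where ?'a = complex] by simp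
  have "Polynomial.lead_coeff (char_poly M) = 1"
    using degree_monic_char_poly[OF M] by simp
  with r show ?thesis by (auto simp: algebraic_int_altdef_ipoly)
qed

text \<open>
  The \<open>\<int>\<close>-module generated by the monomials \<open>x\<^sup>i y\<^sup>j\<close> with \<open>i < n\<close> and \<open>j < m\<close>. For \<open>n\<close> and \<open>m\<close>
  the degrees of monic integer polynomials that vanish at \<open>x\<close> and \<open>y\<close>, it is the ring
  \<open>\<int>[x, y]\<close>.
\<close>

definition int_span2 :: "nat \<Rightarrow> nat \<Rightarrow> complex \<Rightarrow> complex \<Rightarrow> complex set" where
  "int_span2 n m x y =
     range (\<lambda>c :: nat \<Rightarrow> nat \<Rightarrow> int. \<Sum>i<n. \<Sum>j<m. of_int (c i j) * (x ^ i * y ^ j))"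

lemma int_span2I:
  "a = (\<Sum>i<n. \<Sum>j<m. of_int (c i j) * (x ^ i * y ^ j)) \<Longrightarrow> a \<in> int_span2 n m x y"
  unfolding int_span2_def by (rule range_eqI[of _ _ c])

lemma int_span2_add: "a \<in> int_span2 n m x y \<Longrightarrow> b \<in> int_span2 n m x y \<Longrightarrow> a + b \<in> int_span2 n m x y"
proof -
  assume "a \<in> int_span2 n m x y" "b \<in> int_span2 n m x y"
  then obtain c e where 
    "a = (\<Sum>i<n. \<Sum>j<m. of_int (c i j) * (x ^ i * y ^ j))"
    "b = (\<Sum>i<n. \<Sum>j<m. of_int (e i j) * (x ^ i * y ^ j))"
    unfolding int_span2_def by blast
  then have "a + b = (\<Sum>i<n. \<Sum>j<m. of_int (c i j + e i j) * (x ^ i * y ^ j))"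
    by (simp add: sum.distrib algebra_simps)
  then show ?thesis by (rule int_span2I)
qed

lemma int_span2_int_mult: "a \<in> int_span2 n m x y \<Longrightarrow> of_int k * a \<in> int_span2 n m x y"
proof -
  assume "a \<in> int_span2 n m x y"
  then obtain c where 
    "a = (\<Sum>i<n. \<Sum>j<m. of_int (c i j) * (x ^ i * y ^ j))"
    unfolding int_span2_def by blast
  then have "of_int k * a = (\<Sum>i<n. \<Sum>j<m. of_int (k * c i j) * (x ^ i * y ^ j))"
    by (simp add: sum_distrib_left algebra_simps)
  then show ?thesis by (rule int_span2I)
qed

lemma int_span2_zero: "0 \<in> int_span2 n m x y"
  unfolding int_span2_def by (rule range_eqI[of _ _ "\<lambda>_ _. 0"]) simp

lemma int_span2_sum: "(\<And>i. i \<in> I \<Longrightarrow> f i \<in> int_span2 n m x y) \<Longrightarrow> (\<Sum>i\<in>I. f i) \<in> int_span2 n m x y"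
  by (induction I rule: infinite_finite_induct) (auto intro: int_span2_add int_span2_zero)

lemma int_span2_generator:
  assumes "i < n" "j < m" shows "x ^ i * y ^ j \<in> int_span2 n m x y"
proof -
  have "(\<Sum>i'<n. \<Sum>j'<m. of_int (if i' = i \<and> j' = j then 1 else 0) * (x ^ i' * y ^ j'))
     = (\<Sum>i'<n. \<Sum>j'<m. if i' = i then (if j' = j then x ^ i' * y ^ j' else 0) else 0)"
    by (intro sum.cong) auto
  also have "\<dots> = (\<Sum>i'<n. if i' = i then (\<Sum>j'<m. if j' = j then x ^ i' * y ^ j' else 0) else 0)"
    by (intro sum.cong) auto
  also have "\<dots> = x ^ i * y ^ j" using assms by simp
  finally show ?thesis unfolding int_span2_def
    by (intro range_eqI[of _ _ "\<lambda>i' j'. if i' = i \<and> j' = j then 1 else 0"]) simp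
qed

lemma int_span2_commute: "int_span2 n m x y = int_span2 m n y x"
proof -
  have "int_span2 n m x y \<subseteq> int_span2 m n y x" for n m x y
  proof
    fix a assume "a \<in> int_span2 n m x y"
    then obtain c where "a = (\<Sum>i<n. \<Sum>j<m. of_int (c i j) * (x ^ i * y ^ j))"
      unfolding int_span2_def by blast
    then have "a = (\<Sum>j<m. \<Sum>i<n. of_int (c i j) * (y ^ j * x ^ i))"
      by (subst sum.swap) (simp add: mult_ac)
    then show "a \<in> int_span2 m n y x" by (rule int_span2I[where c = "\<lambda>j i. c i j"])
  qed
  then show ?thesis by blast
qed

text \<open>
  Only the monomials with the highest power of \<open>x\<close> leave the generating family, and these are
  rewritten by the monic equation of \<open>x\<close>.
\<close>

lemma int_span2_times_left:
  fixes p :: "int poly"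
  assumes p: "Polynomial.lead_coeff p = 1" "poly (map_poly of_int p) x = 0"
    and a: "a \<in> int_span2 (Polynomial.degree p) m x y"
  shows "x * a \<in> int_span2 (Polynomial.degree p) m x y"
proof -
  let ?n = "Polynomial.degree p"
  obtain c where c: "a = (\<Sum>i<?n. \<Sum>j<m. of_int (c i j) * (x ^ i * y ^ j))"
    using a unfolding int_span2_def by blast
  have top: "x ^ ?n = (\<Sum>i<?n. of_int (- Polynomial.coeff p i) * x ^ i)"
  proof -
    have dg: "Polynomial.degree (map_poly of_int p :: complex poly) = ?n"
      by (simp add: degree_map_poly)
    have "0 = (\<Sum>i\<le>?n. of_int (Polynomial.coeff p i) * x ^ i)"
      using p(2) by (simp add: poly_altdef coeff_map_poly dg)
    also have "\<dots> = (\<Sum>i<?n. of_int (Polynomial.coeff p i) * x ^ i) + x ^ ?n"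
      using p(1) by (simp add: lessThan_Suc_atMost[symmetric])
    finally show ?thesis by (simp add: sum_negf eq_neg_iff_add_eq_0 add.commute)
  qed
  have gen: "x * (x ^ i * y ^ j) \<in> int_span2 ?n m x y" if "i < ?n" "j < m" for i j
  proof (cases "Suc i < ?n")
    case True
    then show ?thesis using int_span2_generator[of "Suc i" ?n j m x y] that by (simp add: mult_ac)
  next
    case False
    then have "Suc i = ?n" using that by simp
    then have "x * (x ^ i * y ^ j) = x ^ ?n * y ^ j"
      by (metis mult.assoc power_Suc)
    also have "\<dots> = (\<Sum>i<?n. of_int (- Polynomial.coeff p i) * (x ^ i * y ^ j))"
      by (subst top) (simp add: sum_distrib_right mult.assoc)
    finally show ?thesis
      using that by (auto intro!: int_span2_sum int_span2_int_mult int_span2_generator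
          simp del: of_int_minus)
  qed
  have "x * a = (\<Sum>i<?n. \<Sum>j<m. of_int (c i j) * (x * (x ^ i * y ^ j)))"
    by (simp add: c sum_distrib_left mult_ac)
  also have "\<dots> \<in> int_span2 ?n m x y"
    by (intro int_span2_sum int_span2_int_mult gen) auto
  finally show ?thesis .
qed

text \<open>
  The usual finiteness criterion for integrality: multiplication by \<open>z\<close> is given on the
  generators by an integer matrix, and \<open>1\<close> is a nonzero entry of the vector of generators.
\<close>

lemma algebraic_int_if_stable_int_span2:
  assumes nm: "0 < n" "0 < m"
    and stable: "\<And>a. a \<in> int_span2 n m x y \<Longrightarrow> z * a \<in> int_span2 n m x y"
  shows "algebraic_int z"
proof -
  define v where "v k = x ^ (k div m) * y ^ (k mod m)" for k
  have k: "k div m < n" "k mod m < m" if "k < n * m" for k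
    using that nm by (auto simp: less_mult_imp_div_less)
  have "\<exists>c :: nat \<Rightarrow> int. z * v k = (\<Sum>l<n*m. of_int (c l) * v l)" if "k < n * m" for k
  proof -
    have "z * v k \<in> int_span2 n m x y"
      unfolding v_def by (intro stable int_span2_generator k that)
    then obtain c where "z * v k = (\<Sum>i<n. \<Sum>j<m. of_int (c i j) * (x ^ i * y ^ j))"
      unfolding int_span2_def by blast
    also have "\<dots> = (\<Sum>(i,j)\<in>{..<n}\<times>{..<m}. of_int (c i j) * (x ^ i * y ^ j))"
      by (simp add: sum.cartesian_product)
    also have "\<dots> = (\<Sum>l<n*m. of_int (c (l div m) (l mod m)) * v l)"
    proof (rule sum.reindex_bij_witness[of _ "\<lambda>l. (l div m, l mod m)" "\<lambda>(i,j). i * m + j"])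
      fix q assume "q \<in> {..<n} \<times> {..<m}"
      then obtain i j where q: "q = (i, j)" "i < n" "j < m" by auto
      have "i * m + j < Suc i * m" using q by simp
      also have "\<dots> \<le> n * m" using q by (intro mult_right_mono) auto
      finally show "(case q of (i, j) \<Rightarrow> i * m + j) \<in> {..<n * m}" using q by simp
    qed (use nm k in \<open>auto simp: v_def\<close>)
    finally show ?thesis by (rule exI[of _ "\<lambda>l. c (l div m) (l mod m)"])
  qed
  then obtain A :: "nat \<Rightarrow> nat \<Rightarrow> int" where
    "\<And>k. k < n * m \<Longrightarrow> z * v k = (\<Sum>l<n*m. of_int (A k l) * v l)" by metis
  then show ?thesis
    using nm by (intro algebraic_int_if_int_matrix[of 0 "n * m" v z A]) (auto simp: v_def)
qed

lemma
  fixes x y :: complex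
  assumes "algebraic_int x" "algebraic_int y"
  shows algebraic_int_add: "algebraic_int (x + y)"
    and algebraic_int_mult: "algebraic_int (x * y)"
proof -
  obtain p q :: "int poly" where p: "Polynomial.lead_coeff p = 1" "poly (map_poly of_int p) x = 0"
    and q: "Polynomial.lead_coeff q = 1" "poly (map_poly of_int q) y = 0"
    using assms unfolding algebraic_int_altdef_ipoly by blast
  have pos: "0 < Polynomial.degree r" if "Polynomial.lead_coeff r = 1" "poly (map_poly of_int r) u = 0"
    for r :: "int poly" and u :: complex
  proof (rule ccontr)
    assume "\<not> 0 < Polynomial.degree r"
    then obtain c where "r = [:c:]" by (metis degree_eq_zeroE gr0I)
    then show False using that by (simp add: map_poly_pCons)
  qed
  let ?n = "Polynomial.degree p" and ?m = "Polynomial.degree q"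
  have X: "x * a \<in> int_span2 ?n ?m x y" if "a \<in> int_span2 ?n ?m x y" for a
    using int_span2_times_left[OF p that] .
  have Y: "y * a \<in> int_span2 ?n ?m x y" if "a \<in> int_span2 ?n ?m x y" for a
    using int_span2_times_left[OF q, of a ?n x] that by (simp add: int_span2_commute[of ?n])
  show "algebraic_int (x + y)"
    by (rule algebraic_int_if_stable_int_span2[OF pos[OF p] pos[OF q]])
       (auto simp: distrib_right intro: int_span2_add X Y)
  show "algebraic_int (x * y)"
    by (rule algebraic_int_if_stable_int_span2[OF pos[OF p] pos[OF q]])
       (auto simp: mult.assoc intro: X Y)
qed

lemma algebraic_int_sum_complex:
  "(\<And>i. i \<in> I \<Longrightarrow> algebraic_int (f i :: complex)) \<Longrightarrow> algebraic_int (\<Sum>i\<in>I. f i)"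
  by (induction I rule: infinite_finite_induct) (auto intro: algebraic_int_add)

lemma algebraic_int_prod_complex:
  "(\<And>i. i \<in> I \<Longrightarrow> algebraic_int (f i :: complex)) \<Longrightarrow> algebraic_int (\<Prod>i\<in>I. f i)"
  by (induction I rule: infinite_finite_induct)
     (auto intro: algebraic_int_mult int_imp_algebraic_int)

text \<open>
  The leading coefficient of an integer polynomial that vanishes at \<open>x\<close> is a denominator of \<open>x\<close>.
\<close>

lemma algebraic_clear_denominator:
  fixes x :: complex
  assumes "algebraic x"
  shows "\<exists>D :: nat. D > 0 \<and> algebraic_int (of_nat D * x)"
proof -
  obtain p :: "int poly" where p: "poly (map_poly of_int p) x = 0" "p \<noteq> 0"
    using assms by (elim algebraicE')
  define n where "n = Polynomial.degree p"
  define a where "a = Polynomial.lead_coeff p"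
  have a0: "a \<noteq> 0" using p(2) by (simp add: a_def)
  have n0: "n > 0"
  proof (rule ccontr)
    assume "\<not> n > 0"
    then obtain c where "p = [:c:]" by (metis degree_eq_zeroE gr0I n_def)
    then show False using p by (simp add: map_poly_pCons)
  qed
  have "0 = (\<Sum>i\<le>n. of_int (Polynomial.coeff p i) * x ^ i)"
    using p(1) by (simp add: poly_altdef n_def)
  also have "\<dots> = (\<Sum>i<n. of_int (Polynomial.coeff p i) * x ^ i) + of_int a * x ^ n"
    by (simp add: lessThan_Suc_atMost[symmetric] a_def n_def)
  finally have top: "of_int a * x ^ n = - (\<Sum>i<n. of_int (Polynomial.coeff p i) * x ^ i)"
    by (simp add: eq_neg_iff_add_eq_0 add.commute)
  \<comment> \<open>Multiplication by \<open>a x\<close> shifts the powers \<open>(a x)^i\<close>; the last one is reduced by \<open>p\<close>.\<close>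
  define A where "A i j = (if Suc i < n then (if j = Suc i then 1 else 0)
    else - Polynomial.coeff p j * a ^ (n - 1 - j))" for i j
  have "algebraic_int (of_int a * x)"
  proof (rule algebraic_int_if_int_matrix[of 0 n "\<lambda>i. (of_int a * x) ^ i" _ A])
    fix i assume i: "i < n"
    show "of_int a * x * (of_int a * x) ^ i = (\<Sum>j<n. of_int (A i j) * (of_int a * x) ^ j)"
    proof (cases "Suc i < n")
      case True
      then have "(\<Sum>j<n. of_int (A i j) * (of_int a * x) ^ j)
        = (\<Sum>j<n. if j = Suc i then (of_int a * x) ^ j else 0)"
        by (intro sum.cong) (auto simp: A_def)
      then show ?thesis using True by simp
    next
      case False
      then have n: "n = Suc i" using i by simp
      have "of_int a * x * (of_int a * x) ^ i = of_int a ^ i * (of_int a * x ^ n)"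
        by (simp add: n power_mult_distrib)
      also have "\<dots> = (\<Sum>j<n. - of_int (Polynomial.coeff p j) * (of_int a ^ i * x ^ j))"
        by (simp add: top sum_distrib_left sum_negf mult_ac)
      also have "\<dots> = (\<Sum>j<n. of_int (A i j) * (of_int a * x) ^ j)"
      proof (intro sum.cong refl)
        fix j assume "j \<in> {..<n}"
        then have "of_int a ^ i = (of_int a ^ (n - 1 - j) * of_int a ^ j :: complex)"
          by (simp add: n flip: power_add)
        then show "- of_int (Polynomial.coeff p j) * (of_int a ^ i * x ^ j)
           = of_int (A i j) * (of_int a * x) ^ j"
          using False by (simp add: A_def power_mult_distrib mult_ac)
      qed
      finally show ?thesis .
    qed
  qed (use n0 in auto)
  moreover have "of_nat (nat \<bar>a\<bar>) * x = of_int a * x \<or> of_nat (nat \<bar>a\<bar>) * x = - (of_int a * x)"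
    by (auto simp: abs_if)
  ultimately have "algebraic_int (of_nat (nat \<bar>a\<bar>) * x)" by auto
  then show ?thesis using a0 by (intro exI[of _ "nat \<bar>a\<bar>"]) auto
qed

section \<open>Conjugates and norms\<close>

text \<open>
  Elements of a number field \<open>\<rat>(\<theta>)\<close> are represented as \<open>g(\<theta>)\<close> with \<open>g\<close> a rational polynomial.
  If \<open>f\<close> is irreducible with \<open>f(\<theta>) = 0\<close>, the embeddings of the field into the complex numbers
  are \<open>g(\<theta>) \<mapsto> g(\<theta>')\<close> for the roots \<open>\<theta>'\<close> of \<open>f\<close>: to apply all
  embeddings is to evaluate the same polynomial at all roots.
\<close>

abbreviation rat_eval :: "complex \<Rightarrow> rat poly \<Rightarrow> complex" where
  "rat_eval \<theta> g \<equiv> poly (map_poly of_rat g) \<theta>"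

interpretation of_rat_poly: map_poly_comm_ring_hom "of_rat :: rat \<Rightarrow> complex" ..

lemma rat_eval_hom: "comm_ring_hom (rat_eval \<theta>)"
  by unfold_locales (simp_all add: of_rat_poly.hom_add of_rat_poly.hom_mult)

lemma map_poly_of_rat_of_int:
  "map_poly (of_rat :: rat \<Rightarrow> complex) (map_poly of_int p) = map_poly of_int p"
  by (intro poly_eqI) (simp add: coeff_map_poly)

lemma irreducible_rat_poly_dvd:
  fixes f g :: "rat poly"
  assumes "Factorial_Ring.irreducible f" "rat_eval \<theta> f = 0" "rat_eval \<theta> g = 0"
  shows "f dvd g"
proof (rule ccontr)
  interpret comm_ring_hom "rat_eval \<theta>" by (rule rat_eval_hom)
  assume "\<not> f dvd g"
  then have "Rings.coprime f g"
    using assms(1) by (simp add: irreducible_imp_prime_elem_gcd prime_elem_imp_coprime)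
  then obtain u v where "u * f + v * g = 1"
    using bezout_coefficients_fst_snd[of f g] by (metis coprime_iff_gcd_eq_1)
  then have "rat_eval \<theta> (u * f + v * g) = 1" by (simp only: hom_one)
  then show False using assms(2,3) by (simp add: hom_add hom_mult)
qed

lemma prod_mset_linear_factors_swap:
  fixes A B :: "complex multiset"
  shows "(\<Prod>a\<in>#A. \<Prod>b\<in>#B. a - b) = (-1) ^ (size A * size B) * (\<Prod>b\<in>#B. \<Prod>a\<in>#A. b - a)"
proof (induction A)
  case empty
  then show ?case by simp
next
  case (add x A)
  have "(\<Prod>b\<in>#B. x - b) = (-1) ^ size B * (\<Prod>b\<in>#B. b - x)"
    by (induction B) (auto simp: algebra_simps)
  then show ?case by (simp add: add.IH power_add prod_mset.distrib mult_ac)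
qed

lemma poly_eq_prod_proots:
  fixes f :: "complex poly"
  shows "poly f z = Polynomial.lead_coeff f * (\<Prod>x\<in>#proots f. z - x)"
proof -
  have "poly f z = poly (Polynomial.smult (Polynomial.lead_coeff f) (\<Prod>x\<in>#proots f. [:- x, 1:])) z"
    by (simp only: complex_poly_decompose_multiset)
  also have "\<dots> = Polynomial.lead_coeff f * (\<Prod>x\<in>#proots f. z - x)"
    by (simp add: poly_prod_mset multiset.map_comp o_def)
  finally show ?thesis .
qed

text \<open>
  The product is the resultant of \<open>f\<close> and \<open>g\<close> up to a power of the leading coefficient of \<open>f\<close>.
  It only depends on \<open>g\<close> modulo \<open>f\<close>, and exchanging the two polynomials changes it by a sign and
  by powers of the leading coefficients; so the Euclidean algorithm reduces \<open>f\<close> to a constant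
  without ever leaving the rational numbers.
\<close>

lemma prod_proots_rational:
  fixes f g :: "rat poly"
  assumes "f \<noteq> 0"
  shows "(\<Prod>\<theta>\<in>#proots (map_poly of_rat f). rat_eval \<theta> g) \<in> \<rat>"
  using assms
proof (induction "Polynomial.degree f" arbitrary: f g rule: less_induct)
  case less
  let ?r = "map_poly (of_rat :: rat \<Rightarrow> complex)"
  define r where "r = g mod f"
  have f0: "?r f \<noteq> 0" using less.prems by simp
  have rep: "rat_eval \<theta> g = rat_eval \<theta> r" if "rat_eval \<theta> f = 0" for \<theta>
  proof -
    interpret comm_ring_hom "rat_eval \<theta>" by (rule rat_eval_hom)
    have "rat_eval \<theta> (g div f * f + g mod f) = rat_eval \<theta> r"
      using that by (simp only: hom_add hom_mult r_def) simp
    then show ?thesis by simp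
  qed
  have eq: "(\<Prod>\<theta>\<in>#proots (?r f). rat_eval \<theta> g) = (\<Prod>\<theta>\<in>#proots (?r f). rat_eval \<theta> r)"
    by (rule arg_cong[where f = prod_mset], rule image_mset_cong) (use f0 in \<open>auto simp: rep\<close>)
  show ?case
  proof (cases "r = 0")
    case True
    then show ?thesis unfolding eq by (cases "proots (?r f)") auto
  next
    case False
    show ?thesis
    proof (cases "Polynomial.degree f = 0")
      case True
      then obtain c where "f = [:c:]" by (metis degree_eq_zeroE)
      moreover have "?r [:c:] = [:of_rat c:]"
        by (intro poly_eqI) (simp add: coeff_map_poly coeff_pCons split: nat.split)
      ultimately show ?thesis by simp
    next
      case False': False
      have dr: "Polynomial.degree r < Polynomial.degree f"
        using False False' unfolding r_def by (metis degree_mod_less_degree gr_zeroI less.prems mod_eq_0_iff_dvd)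
      have IH: "(\<Prod>\<rho>\<in>#proots (?r r). rat_eval \<rho> f) \<in> \<rat>"
        using less.hyps[OF dr False] .
      define cf cr where "cf = Polynomial.lead_coeff (?r f)" and "cr = Polynomial.lead_coeff (?r r)"
      have cfr: "cf \<in> \<rat>" "cr \<in> \<rat>" "cf \<noteq> 0"
        using f0 by (auto simp: cf_def cr_def)
      let ?A = "proots (?r f)" and ?B = "proots (?r r)"
      have A: "(\<Prod>\<rho>\<in>#?B. rat_eval \<rho> f) = cf ^ size ?B * (\<Prod>\<rho>\<in>#?B. \<Prod>\<theta>\<in>#?A. \<rho> - \<theta>)"
        by (subst poly_eq_prod_proots) (simp add: cf_def prod_mset.distrib)
      then have "(\<Prod>\<rho>\<in>#?B. \<Prod>\<theta>\<in>#?A. \<rho> - \<theta>) = (\<Prod>\<rho>\<in>#?B. rat_eval \<rho> f) / cf ^ size ?B"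
        using cfr by simp
      then have rB: "(\<Prod>\<rho>\<in>#?B. \<Prod>\<theta>\<in>#?A. \<rho> - \<theta>) \<in> \<rat>"
        using IH cfr by (simp add: Rats_divide Rats_power)
      have "(\<Prod>\<theta>\<in>#?A. rat_eval \<theta> r) = cr ^ size ?A * (\<Prod>\<theta>\<in>#?A. \<Prod>\<rho>\<in>#?B. \<theta> - \<rho>)"
        by (subst poly_eq_prod_proots) (simp add: cr_def prod_mset.distrib)
      also have "\<dots> = cr ^ size ?A * ((-1) ^ (size ?A * size ?B) * (\<Prod>\<rho>\<in>#?B. \<Prod>\<theta>\<in>#?A. \<rho> - \<theta>))"
        by (subst prod_mset_linear_factors_swap) (rule refl)
      also have "\<dots> \<in> \<rat>"
        using rB cfr by (intro Rats_mult Rats_power) auto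
      finally show ?thesis unfolding eq .
    qed
  qed
qed

text \<open>
  A monic integer polynomial \<open>p\<close> that vanishes at \<open>g(\<theta>)\<close> gives \<open>p(g(X))\<close>, a multiple of the
  minimal polynomial \<open>f\<close>; hence \<open>p\<close> vanishes at \<open>g(\<theta>')\<close> too.
\<close>

lemma algebraic_int_conjugate_value:
  fixes f g :: "rat poly"
  assumes f: "Factorial_Ring.irreducible f" "rat_eval \<theta> f = 0" "rat_eval \<theta>' f = 0"
    and int: "algebraic_int (rat_eval \<theta> g)"
  shows "algebraic_int (rat_eval \<theta>' g)"
proof -
  obtain p :: "int poly" where p: "poly (map_poly of_int p) (rat_eval \<theta> g) = 0"
    "Polynomial.lead_coeff p = 1"
    using int unfolding algebraic_int_altdef_ipoly by blast
  have comp: "rat_eval t (pcompose (map_poly of_int p) g) = poly (map_poly of_int p) (rat_eval t g)" for t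
    by (simp add: of_rat_hom.map_poly_pcompose poly_pcompose map_poly_of_rat_of_int)
  have "f dvd pcompose (map_poly of_int p) g"
    by (rule irreducible_rat_poly_dvd[OF f(1,2)]) (simp add: comp p)
  then obtain h where h: "pcompose (map_poly of_int p) g = f * h" by (elim dvdE)
  interpret comm_ring_hom "rat_eval \<theta>'" by (rule rat_eval_hom)
  have "rat_eval \<theta>' (f * h) = 0" using f(3) by (simp only: hom_mult) simp
  then have "poly (map_poly of_int p) (rat_eval \<theta>' g) = 0" by (metis comp h)
  then show ?thesis using p(2) unfolding algebraic_int_altdef_ipoly by blast
qed

text \<open>
  By the same divisibility argument the values \<open>g(\<theta>')\<close> are conjugates of \<open>g(\<theta>)\<close>. This is the
  only way in which the height of \<open>P\<close> enters the proof.
\<close>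

lemma house_ge_conjugate_value:
  fixes f g :: "rat poly"
  assumes f: "Factorial_Ring.irreducible f" "rat_eval \<theta> f = 0" "rat_eval \<theta>' f = 0"
    and alg: "algebraic (rat_eval \<theta> g)"
  shows "norm (rat_eval \<theta>' g) \<le> house (rat_eval \<theta> g)"
proof -
  obtain p :: "rat poly" where p: "Factorial_Ring.irreducible p" "rat_eval (rat_eval \<theta> g) p = 0"
    using irreducible_rat_poly_exists[OF alg] by blast
  have comp: "rat_eval t (pcompose p g) = rat_eval (rat_eval t g) p" for t
    by (simp add: of_rat_hom.map_poly_pcompose poly_pcompose)
  have "f dvd pcompose p g"
    by (rule irreducible_rat_poly_dvd[OF f(1,2)]) (simp add: comp p)
  then obtain h where h: "pcompose p g = f * h" by (elim dvdE)
  interpret comm_ring_hom "rat_eval \<theta>'" by (rule rat_eval_hom)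
  have "rat_eval \<theta>' (f * h) = 0" using f(3) by (simp only: hom_mult) simp
  then have "rat_eval (rat_eval \<theta>' g) p = 0" by (metis comp h)
  then have "rat_eval \<theta>' g \<in> conjugates (rat_eval \<theta> g)"
    using p unfolding conjugates_def by blast
  then show ?thesis unfolding house_def
    by (intro Max_ge) (auto intro: finite_conjugates)
qed

text \<open>
  The norm of a nonzero algebraic integer is a nonzero rational integer.
\<close>

lemma prod_conjugate_values_ge_1:
  fixes f g :: "rat poly"
  assumes f: "Factorial_Ring.irreducible f" "rat_eval \<theta> f = 0"
    and int: "algebraic_int (rat_eval \<theta> g)" and nz: "rat_eval \<theta> g \<noteq> 0"
  shows "1 \<le> (\<Prod>\<theta>'\<in>#proots (map_poly of_rat f). norm (rat_eval \<theta>' g))"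
proof -
  let ?A = "proots (map_poly of_rat f) :: complex multiset"
  have f0: "map_poly of_rat f \<noteq> (0 :: complex poly)" using f(1) by auto
  have root: "rat_eval t f = 0" if "t \<in># ?A" for t using that f0 by simp
  let ?N = "\<Prod>\<theta>'\<in>#?A. rat_eval \<theta>' g"
  have rat: "?N \<in> \<rat>" by (rule prod_proots_rational) (use f(1) in auto)
  have intp: "algebraic_int (\<Prod>t\<in>#B. rat_eval t g)" if "B \<subseteq># ?A" for B
    using that
  proof (induction B)
    case (add x B)
    then have "x \<in># ?A" "B \<subseteq># ?A"
      by (auto dest: mset_subset_eq_insertD intro: subset_mset.less_imp_le)
    then show ?case using add.IH algebraic_int_conjugate_value[OF f root int]
      by (auto intro!: algebraic_int_mult)
  qed (simp add: int_imp_algebraic_int)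
  have "?N \<in> \<int>"
    using rational_algebraic_int_is_int[OF intp[of ?A]] rat by simp
  moreover have "?N \<noteq> 0"
  proof
    assume "?N = 0"
    then obtain t where t: "t \<in># ?A" "rat_eval t g = 0" by auto
    have "f dvd g" by (rule irreducible_rat_poly_dvd[OF f(1) root t(2)]) (use t in auto)
    then obtain h where h: "g = f * h" by (elim dvdE)
    interpret comm_ring_hom "rat_eval \<theta>" by (rule rat_eval_hom)
    show False using nz f(2) by (simp only: h hom_mult) simp
  qed
  ultimately have "1 \<le> norm ?N"
    by (elim Ints_cases) (simp add: int_one_le_iff_zero_less flip: of_int_abs)
  also have "norm ?N = (\<Prod>\<theta>'\<in>#?A. norm (rat_eval \<theta>' g))"
  proof -
    have "norm (\<Prod>t\<in>#B. rat_eval t g) = (\<Prod>t\<in>#B. norm (rat_eval t g))" for B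
      by (induction B) (auto simp: norm_mult)
    then show ?thesis .
  qed
  finally show ?thesis .
qed

section \<open>Primitive elements\<close>

definition rat_adjoin :: "complex \<Rightarrow> complex set" where
  "rat_adjoin \<theta> = range (rat_eval \<theta>)"

lemma rat_adjoinI: "x = rat_eval \<theta> g \<Longrightarrow> x \<in> rat_adjoin \<theta>"
  unfolding rat_adjoin_def by blast

lemma rat_adjoin_closed:
  shows rat_adjoin_add: "a \<in> rat_adjoin \<theta> \<Longrightarrow> b \<in> rat_adjoin \<theta> \<Longrightarrow> a + b \<in> rat_adjoin \<theta>"
    and rat_adjoin_mult: "a \<in> rat_adjoin \<theta> \<Longrightarrow> b \<in> rat_adjoin \<theta> \<Longrightarrow> a * b \<in> rat_adjoin \<theta>"
    and rat_adjoin_minus: "a \<in> rat_adjoin \<theta> \<Longrightarrow> - a \<in> rat_adjoin \<theta>"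
    and rat_adjoin_of_rat: "of_rat r \<in> rat_adjoin \<theta>"
    and rat_adjoin_self: "\<theta> \<in> rat_adjoin \<theta>"
proof -
  interpret comm_ring_hom "rat_eval \<theta>" by (rule rat_eval_hom)
  show "a \<in> rat_adjoin \<theta> \<Longrightarrow> b \<in> rat_adjoin \<theta> \<Longrightarrow> a + b \<in> rat_adjoin \<theta>"
  proof -
    assume "a \<in> rat_adjoin \<theta>" "b \<in> rat_adjoin \<theta>"
    then obtain g k where "a = rat_eval \<theta> g" "b = rat_eval \<theta> k" unfolding rat_adjoin_def by blast
    then show "a + b \<in> rat_adjoin \<theta>" by (intro rat_adjoinI[where g = "g + k"]) (simp only: hom_add)
  qed
  show "a \<in> rat_adjoin \<theta> \<Longrightarrow> b \<in> rat_adjoin \<theta> \<Longrightarrow> a * b \<in> rat_adjoin \<theta>"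
  proof -
    assume "a \<in> rat_adjoin \<theta>" "b \<in> rat_adjoin \<theta>"
    then obtain g k where "a = rat_eval \<theta> g" "b = rat_eval \<theta> k" unfolding rat_adjoin_def by blast
    then show "a * b \<in> rat_adjoin \<theta>" by (intro rat_adjoinI[where g = "g * k"]) (simp only: hom_mult)
  qed
  show "a \<in> rat_adjoin \<theta> \<Longrightarrow> - a \<in> rat_adjoin \<theta>"
  proof -
    assume "a \<in> rat_adjoin \<theta>"
    then obtain g where "a = rat_eval \<theta> g" unfolding rat_adjoin_def by blast
    then show "- a \<in> rat_adjoin \<theta>" by (intro rat_adjoinI[where g = "- g"]) (simp only: hom_uminus)
  qed
  have c: "map_poly of_rat [:r, s:] = [:of_rat r, of_rat s :: complex:]" for r s :: rat
    by (intro poly_eqI) (simp add: coeff_map_poly coeff_pCons split: nat.split)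
  show "of_rat r \<in> rat_adjoin \<theta>" by (rule rat_adjoinI[where g = "[:r, 0:]"]) (simp only: c, simp)
  show "\<theta> \<in> rat_adjoin \<theta>" by (rule rat_adjoinI[where g = "[:0, 1:]"]) (simp only: c, simp)
qed

lemma rat_adjoin_inverse:
  assumes "algebraic \<theta>" "a \<in> rat_adjoin \<theta>"
  shows "inverse a \<in> rat_adjoin \<theta>"
proof (cases "a = 0")
  case True
  then show ?thesis using rat_adjoin_of_rat[of 0 \<theta>] by simp
next
  case False
  interpret comm_ring_hom "rat_eval \<theta>" by (rule rat_eval_hom)
  obtain f :: "rat poly" where f: "Factorial_Ring.irreducible f" "rat_eval \<theta> f = 0"
    using irreducible_rat_poly_exists[OF assms(1)] by blast
  obtain g where g: "a = rat_eval \<theta> g" using assms(2) unfolding rat_adjoin_def by blast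
  have "\<not> f dvd g"
  proof
    assume "f dvd g"
    then obtain h where "g = f * h" by (elim dvdE)
    then show False using False f(2) by (simp only: g hom_mult) simp
  qed
  then have "Rings.coprime f g"
    using f(1) by (simp add: irreducible_imp_prime_elem_gcd prime_elem_imp_coprime)
  then obtain u v where "u * f + v * g = 1"
    using bezout_coefficients_fst_snd[of f g] by (metis coprime_iff_gcd_eq_1)
  then have "rat_eval \<theta> (u * f + v * g) = 1" by (simp only: hom_one)
  then have "a * rat_eval \<theta> v = 1" using f(2) by (simp only: hom_add hom_mult g) (simp add: mult.commute)
  then have "inverse a = rat_eval \<theta> v" by (rule inverse_unique)
  then show ?thesis by (rule rat_adjoinI)
qed

lemma rat_adjoin_power: "a \<in> rat_adjoin \<theta> \<Longrightarrow> a ^ n \<in> rat_adjoin \<theta>"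
  using rat_adjoin_of_rat[of 1 \<theta>] by (induction n) (auto intro: rat_adjoin_mult)

lemma rat_adjoin_sum: "(\<And>i. i \<in> I \<Longrightarrow> f i \<in> rat_adjoin \<theta>) \<Longrightarrow> (\<Sum>i\<in>I. f i) \<in> rat_adjoin \<theta>"
  using rat_adjoin_of_rat[of 0 \<theta>]
  by (induction I rule: infinite_finite_induct) (auto intro: rat_adjoin_add)

lemma rat_adjoin_poly:
  assumes "\<And>i. Polynomial.coeff p i \<in> rat_adjoin \<theta>" "a \<in> rat_adjoin \<theta>"
  shows "poly p a \<in> rat_adjoin \<theta>"
  unfolding poly_altdef by (intro rat_adjoin_sum rat_adjoin_mult rat_adjoin_power assms)

lemma rat_adjoin_subset:
  assumes "a \<in> rat_adjoin \<theta>" shows "rat_adjoin a \<subseteq> rat_adjoin \<theta>"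
proof
  fix x assume "x \<in> rat_adjoin a"
  then obtain g where "x = rat_eval a g" unfolding rat_adjoin_def by blast
  then show "x \<in> rat_adjoin \<theta>" using assms
    by (auto intro!: rat_adjoin_poly simp: coeff_map_poly rat_adjoin_of_rat)
qed

lemma rat_adjoin_coeff_mult:
  assumes "\<And>i. Polynomial.coeff p i \<in> rat_adjoin \<theta>" "\<And>i. Polynomial.coeff q i \<in> rat_adjoin \<theta>"
  shows "Polynomial.coeff (p * q) i \<in> rat_adjoin \<theta>"
  unfolding coeff_mult by (intro rat_adjoin_sum rat_adjoin_mult assms)

lemma rat_adjoin_coeff_pcompose:
  assumes "\<And>i. Polynomial.coeff p i \<in> rat_adjoin \<theta>" "\<And>i. Polynomial.coeff q i \<in> rat_adjoin \<theta>"
  shows "Polynomial.coeff (pcompose p q) i \<in> rat_adjoin \<theta>"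
  using assms(1)
proof (induction p arbitrary: i rule: pCons_induct)
  case 0
  then show ?case using rat_adjoin_of_rat[of 0 \<theta>] by simp
next
  case (pCons a p)
  have p: "Polynomial.coeff p i \<in> rat_adjoin \<theta>" for i using pCons.prems[of "Suc i"] by simp
  have "a \<in> rat_adjoin \<theta>" using pCons.prems[of 0] by simp
  then have "Polynomial.coeff [:a:] i \<in> rat_adjoin \<theta>"
    using rat_adjoin_of_rat[of 0 \<theta>] by (simp add: coeff_pCons split: nat.split)
  then show ?case
    unfolding pcompose_pCons coeff_add
    by (intro rat_adjoin_add rat_adjoin_coeff_mult pCons.IH assms(2) p)
qed

text \<open>
  Division with remainder by a monic polynomial only uses ring operations on the coefficients.
\<close>

lemma rat_adjoin_division:
  fixes g p :: "complex poly"
  assumes g: "\<And>i. Polynomial.coeff g i \<in> rat_adjoin \<theta>" "Polynomial.lead_coeff g = 1" 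
    and p: "\<And>i. Polynomial.coeff p i \<in> rat_adjoin \<theta>"
  shows "\<exists>q r. p = q * g + r \<and> (\<forall>i. Polynomial.coeff r i \<in> rat_adjoin \<theta>) \<and>
    (r = 0 \<or> Polynomial.degree r < Polynomial.degree g)"
  using p
proof (induction "Polynomial.degree p" arbitrary: p rule: less_induct)
  case less
  show ?case
  proof (cases "p = 0 \<or> Polynomial.degree p < Polynomial.degree g")
    case True
    then show ?thesis using less.prems by (intro exI[of _ 0] exI[of _ p]) auto
  next
    case False
    define m where "m = Polynomial.monom (Polynomial.lead_coeff p) (Polynomial.degree p - Polynomial.degree g)"
    define p' where "p' = p - m * g"
    have g0: "g \<noteq> 0" using g(2) by auto
    have m0: "m \<noteq> 0" using False by (simp add: m_def)
    have cm: "Polynomial.coeff m i \<in> rat_adjoin \<theta>" for i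
      using less.prems rat_adjoin_of_rat[of 0 \<theta>] by (simp add: m_def)
    have c': "Polynomial.coeff p' i \<in> rat_adjoin \<theta>" for i
      using rat_adjoin_add[OF less.prems[of i] rat_adjoin_minus[OF rat_adjoin_coeff_mult[OF cm g(1), of i]]]
      by (simp add: p'_def)
    have dm: "Polynomial.degree (m * g) = Polynomial.degree p"
      using False g0 m0 by (simp add: degree_mult_eq m_def degree_monom_eq)
    have lm: "Polynomial.lead_coeff (m * g) = Polynomial.lead_coeff p"
      using g(2) m0 by (simp add: lead_coeff_mult m_def degree_monom_eq)
    have le: "Polynomial.degree p' \<le> Polynomial.degree p"
      unfolding p'_def using dm by (intro degree_diff_le) auto
    have z: "Polynomial.coeff p' (Polynomial.degree p) = 0"
      using lm dm by (simp add: p'_def)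
    show ?thesis
    proof (cases "Polynomial.degree p' < Polynomial.degree p")
      case True
      obtain q r where "p' = q * g + r" "\<forall>i. Polynomial.coeff r i \<in> rat_adjoin \<theta>"
        "r = 0 \<or> Polynomial.degree r < Polynomial.degree g"
        using less.hyps[OF True c'] by blast
      then show ?thesis
        by (intro exI[of _ "q + m"] exI[of _ r]) (auto simp: p'_def algebra_simps)
    next
      case False
      then have "p' = 0" using z le by (metis le_neq_implies_less leading_coeff_0_iff)
      then show ?thesis using rat_adjoin_of_rat[of 0 \<theta>]
        by (intro exI[of _ m] exI[of _ 0]) (auto simp: p'_def)
    qed
  qed
qed

text \<open>
  Let \<open>g\<close> be the minimal polynomial of \<open>b\<close> over \<open>\<rat>(\<theta>)\<close>. It divides \<open>p\<close> and \<open>q\<close>, so \<open>b\<close>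
  is its only root and \<open>g = (X - b)\<^sup>e\<close>. In characteristic zero the second highest coefficient
  of this power determines \<open>b\<close>.
\<close>

lemma common_root_in_rat_adjoin:
  fixes b :: complex and p q :: "complex poly"
  assumes \<theta>: "algebraic \<theta>"
    and p: "\<And>i. Polynomial.coeff p i \<in> rat_adjoin \<theta>" "p \<noteq> 0" "poly p b = 0"
    and q: "\<And>i. Polynomial.coeff q i \<in> rat_adjoin \<theta>" "poly q b = 0"
    and common: "\<And>x. poly p x = 0 \<Longrightarrow> poly q x = 0 \<Longrightarrow> x = b"
  shows "b \<in> rat_adjoin \<theta>"
proof -
  define I where "I h \<longleftrightarrow> h \<noteq> 0 \<and> poly h b = 0 \<and> (\<forall>i. Polynomial.coeff h i \<in> rat_adjoin \<theta>)" for h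
  define h where "h = (ARG_MIN Polynomial.degree h. I h)"
  have "I p" using p by (simp add: I_def)
  then have h: "I h" and min: "\<And>h'. I h' \<Longrightarrow> Polynomial.degree h \<le> Polynomial.degree h'"
    unfolding h_def by (auto intro: arg_min_natI arg_min_nat_le)
  \<comment> \<open>\<open>h\<close> has least degree in the ideal of polynomials over \<open>\<rat>(\<theta>)\<close> that vanish at \<open>b\<close>; \<open>g\<close> is monic.\<close>
  define g where "g = Polynomial.smult (inverse (Polynomial.lead_coeff h)) h"
  have h0: "h \<noteq> 0" using h by (simp add: I_def)
  have dg: "Polynomial.degree g = Polynomial.degree h" using h0 by (simp add: g_def)
  have monic: "Polynomial.lead_coeff g = 1" using h0 by (simp add: g_def)
  have gb: "poly g b = 0" using h by (simp add: g_def I_def)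
  have cg: "Polynomial.coeff g i \<in> rat_adjoin \<theta>" for i
    using h unfolding I_def g_def by (auto intro!: rat_adjoin_mult rat_adjoin_inverse[OF \<theta>])
  have dvd: "g dvd p'" if p': "\<And>i. Polynomial.coeff p' i \<in> rat_adjoin \<theta>" "poly p' b = 0" for p'
  proof -
    obtain k r where kr: "p' = k * g + r" "\<forall>i. Polynomial.coeff r i \<in> rat_adjoin \<theta>"
        "r = 0 \<or> Polynomial.degree r < Polynomial.degree g"
      using rat_adjoin_division[OF cg monic p'(1)] by blast
    have "r = 0"
    proof (rule ccontr)
      assume "r \<noteq> 0"
      have "poly r b = 0" using p'(2) gb kr(1) by simp
      then have "I r" using kr(2) \<open>r \<noteq> 0\<close> by (simp add: I_def)
      from min[OF this] show False using kr(3) \<open>r \<noteq> 0\<close> dg by simp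
    qed
    then show ?thesis using kr(1) by simp
  qed
  have roots: "x = b" if "poly g x = 0" for x
  proof -
    have "poly h' x = 0" if "g dvd h'" for h'
      using that \<open>poly g x = 0\<close> by (metis dvd_def mult_zero_left poly_mult)
    then show ?thesis using common[of x] dvd[OF p(1,3)] dvd[OF q(1,2)] by blast
  qed
  have g0: "g \<noteq> 0" using monic by auto
  define e where "e = Polynomial.degree g"
  have "proots g = replicate_mset e b"
  proof -
    have "set_mset (proots g) \<subseteq> {b}" using roots g0 by auto
    then have "proots g = replicate_mset (size (proots g)) b"
      by (metis set_mset_subset_singletonD)
    then show ?thesis by (simp add: size_proots_complex e_def)
  qed
  then have ge: "g = [:-b, 1:] ^ e"
    using complex_poly_decompose_multiset[of g] monic by simp
  have e0: "e > 0" using gb ge by (cases e) auto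
  \<comment> \<open>the second highest coefficient of \<open>(X - b)^e\<close> is \<open>- e b\<close>\<close>
  have "Polynomial.coeff ([:-b, 1:] ^ e) (e - 1) = of_nat e * (- b)"
  proof -
    have "e choose (e - 1) = e" using e0 binomial_symmetric[of "e - 1" e] by simp
    then show ?thesis using e0 by (subst coeff_linear_poly_power) auto
  qed
  then have "of_nat e * (- b) \<in> rat_adjoin \<theta>" using cg[of "e - 1"] unfolding ge by (simp only:)
  then have "of_rat (- inverse (of_nat e)) * (of_nat e * (- b)) \<in> rat_adjoin \<theta>"
    by (rule rat_adjoin_mult[OF rat_adjoin_of_rat])
  moreover have "of_rat (- inverse (of_nat e)) * (of_nat e * (- b)) = b"
    using e0 by (simp add: of_rat_minus of_rat_inverse flip: mult.assoc)
  ultimately show ?thesis by simp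
qed

text \<open>
  The primitive element theorem for two elements. Put \<open>t = a + c b\<close>. Then \<open>b\<close> is a common root
  of its own minimal polynomial and of \<open>f(t - c X)\<close>, where \<open>f\<close> is the minimal polynomial of \<open>a\<close>,
  and for all but finitely many \<open>c\<close> there is no other common root.
\<close>

lemma rat_adjoin_two:
  fixes a b :: complex
  assumes alg: "algebraic a" "algebraic b"
    and algt: "\<And>c :: nat. algebraic (a + of_nat c * b)"
  shows "\<exists>c :: nat. a \<in> rat_adjoin (a + of_nat c * b) \<and> b \<in> rat_adjoin (a + of_nat c * b)"
proof -
  let ?r = "map_poly (of_rat :: rat \<Rightarrow> complex)"
  obtain f :: "rat poly" where f: "Factorial_Ring.irreducible f" "rat_eval a f = 0"
    using irreducible_rat_poly_exists[OF alg(1)] by blast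
  obtain h :: "rat poly" where h: "Factorial_Ring.irreducible h" "rat_eval b h = 0"
    using irreducible_rat_poly_exists[OF alg(2)] by blast
  have nz: "?r f \<noteq> 0" "?r h \<noteq> 0" using f h by auto
  \<comment> \<open>the slopes for which another root of \<open>h\<close> would also be common\<close>
  define B where "B = (\<lambda>(a', b'). (a' - a) / (b - b')) ` ({x. poly (?r f) x = 0} \<times> {x. poly (?r h) x = 0})"
  have "finite B" unfolding B_def by (intro finite_imageI finite_cartesian_product poly_roots_finite nz)
  then have "finite {c :: nat. of_nat c \<in> B}"
    using finite_vimageI[of B "of_nat :: nat \<Rightarrow> complex"] by (simp add: inj_on_def vimage_def)
  then obtain c :: nat where c: "of_nat c \<notin> B" using ex_new_if_finite[OF infinite_UNIV_nat] by blast
  define t where "t = a + of_nat c * b"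
  define q where "q = pcompose (?r f) [:t, - of_nat c:]"
  have algt': "algebraic t" using algt by (simp add: t_def)
  have rt: "Polynomial.coeff (?r g) i \<in> rat_adjoin t" for g i
    by (simp add: coeff_map_poly rat_adjoin_of_rat)
  have cq: "Polynomial.coeff q i \<in> rat_adjoin t" for i
  proof -
    have "Polynomial.coeff [:t, - of_nat c:] i \<in> rat_adjoin t" for i
      using rat_adjoin_of_rat[of 0 t] rat_adjoin_of_rat[of "- of_nat c" t] rat_adjoin_self[of t]
      by (auto simp: coeff_pCons of_rat_minus split: nat.split)
    then show ?thesis unfolding q_def by (intro rat_adjoin_coeff_pcompose rt)
  qed
  have "b \<in> rat_adjoin t"
  proof (rule common_root_in_rat_adjoin[OF algt' rt nz(2) h(2) cq])
    show "poly q b = 0" using f(2) by (simp add: q_def poly_pcompose t_def algebra_simps)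
    fix x assume x: "poly (?r h) x = 0" "poly q x = 0"
    have "poly (?r f) (a + of_nat c * (b - x)) = 0"
      using x(2) by (simp add: q_def poly_pcompose t_def algebra_simps)
    then have "x \<noteq> b \<Longrightarrow> of_nat c \<in> B"
      using x(1) unfolding B_def by (intro image_eqI[of _ _ "(a + of_nat c * (b - x), x)"]) auto
    then show "x = b" using c by blast
  qed
  moreover have "a = t + of_rat (- of_nat c) * b" by (simp add: t_def of_rat_minus)
  moreover have "t + of_rat (- of_nat c) * b \<in> rat_adjoin t"
    using \<open>b \<in> rat_adjoin t\<close> by (intro rat_adjoin_add rat_adjoin_mult rat_adjoin_of_rat rat_adjoin_self)
  ultimately have "b \<in> rat_adjoin t" "a \<in> rat_adjoin t" by auto
  then show ?thesis unfolding t_def by blast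
qed

text \<open>
  The elements of \<open>B\<close> are adjoined one after the other. For \<open>B\<close> a basis of an extension of finite
  degree this gives a primitive element.
\<close>

lemma primitive_element_finite:
  assumes alg: "\<And>x. x \<in> L \<Longrightarrow> algebraic x"
    and L: "0 \<in> L" "\<And>x y. x \<in> L \<Longrightarrow> y \<in> L \<Longrightarrow> x + y \<in> L"
    and fin: "finite B" "B \<subseteq> L"
  shows "\<exists>\<theta>\<in>L. B \<subseteq> rat_adjoin \<theta>"
  using fin
proof (induction B rule: finite_induct)
  case empty
  then show ?case using L by auto
next
  case (insert b B)
  then obtain \<theta> where \<theta>: "\<theta> \<in> L" "B \<subseteq> rat_adjoin \<theta>" by auto
  have bL: "b \<in> L" using insert.prems by simp
  have L': "\<theta> + of_nat c * b \<in> L" for c :: nat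
  proof (induction c)
    case (Suc c)
    have "\<theta> + of_nat (Suc c) * b = (\<theta> + of_nat c * b) + b" by (simp add: algebra_simps)
    then show ?case using L(2)[OF Suc.IH bL] by (simp only:)
  qed (use \<theta> in simp)
  obtain c :: nat where "\<theta> \<in> rat_adjoin (\<theta> + of_nat c * b)" "b \<in> rat_adjoin (\<theta> + of_nat c * b)"
    using rat_adjoin_two[of \<theta> b] alg L' \<theta> bL by blast
  then show ?case using \<theta> L' rat_adjoin_subset by blast
qed

section \<open>Extensions of finite degree over the rational numbers\<close>

text \<open>
  The notion of degree in the definitions lives on a record with explicit carrier. The following
  lemmas extract from it the two facts that are needed about an extension of degree \<open>d\<close>: it is
  spanned by finitely many elements, and each of its elements is a root of a nonzero rational
  polynomial of degree at most \<open>d\<close>.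
\<close>

lemma complex_field_simps [simp]:
  "carrier complex_field = UNIV" "\<one>\<^bsub>complex_field\<^esub> = 1" "\<zero>\<^bsub>complex_field\<^esub> = 0"
  "a \<otimes>\<^bsub>complex_field\<^esub> b = a * b" "a \<oplus>\<^bsub>complex_field\<^esub> b = a + b"
  by (simp_all add: ring_of_type_algebra_def)

interpretation complex_field: ring complex_field
  by (rule ring_from_type_algebra)

lemma complex_field_minus [simp]: "\<ominus>\<^bsub>complex_field\<^esub> a = - a"
  by (rule complex_field.add.inv_equality) simp_all

lemma complex_field_inv: "a \<noteq> 0 \<Longrightarrow> inv\<^bsub>complex_field\<^esub> a = inverse a"
  using comm_monoid.comm_inv_char[of complex_field a "inverse a"] cring.axioms(2)[OF cring_from_type_algebra]
  by simp

lemma subfield_Rats: "subfield \<rat> complex_field"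
  by (rule field.subfieldI'[OF field_from_type_algebra], rule complex_field.subringI)
     (auto simp: complex_field_inv Rats_inverse)

lemma complex_field_combine:
  "complex_field.combine Ks Us = (\<Sum>i<min (length Ks) (length Us). Ks ! i * Us ! i)"
  by (induction Ks Us rule: complex_field.combine.induct)
     (simp_all add: sum.lessThan_Suc_shift del: sum.lessThan_Suc)

lemma has_degree_over_rat_spanning:
  assumes "has_degree_over_rat L d"
  shows "\<exists>B. finite B \<and> B \<subseteq> L \<and> (\<forall>\<theta>. B \<subseteq> rat_adjoin \<theta> \<longrightarrow> L \<subseteq> rat_adjoin \<theta>)"
proof -
  obtain Vs where Vs: "complex_field.independent \<rat> Vs" "complex_field.Span \<rat> Vs = L"
    using complex_field.exists_base[OF subfield_Rats] assms
    unfolding has_degree_over_rat_def by blast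
  have L: "L = {complex_field.combine Ks Vs | Ks. set Ks \<subseteq> \<rat>}"
    using complex_field.Span_eq_combine_set[OF subfield_Rats, of Vs] Vs(2) by simp
  have "set Vs \<subseteq> L"
    using complex_field.Span_base_incl[OF subfield_Rats, of Vs] Vs(2) by simp
  moreover have "L \<subseteq> rat_adjoin \<theta>" if "set Vs \<subseteq> rat_adjoin \<theta>" for \<theta>
  proof
    fix x assume "x \<in> L"
    then obtain Ks where Ks: "set Ks \<subseteq> \<rat>" "x = complex_field.combine Ks Vs" using L by blast
    have "r \<in> rat_adjoin \<theta>" if "r \<in> \<rat>" for r
      using that by (auto elim: Rats_cases intro: rat_adjoin_of_rat)
    then have "Ks ! i \<in> rat_adjoin \<theta>" if "i < length Ks" for i
      using Ks(1) that nth_mem by blast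
    moreover have "Vs ! i \<in> rat_adjoin \<theta>" if "i < length Vs" for i
      using \<open>set Vs \<subseteq> rat_adjoin \<theta>\<close> that nth_mem by blast
    ultimately show "x \<in> rat_adjoin \<theta>"
      unfolding Ks(2) complex_field_combine by (auto intro!: rat_adjoin_sum rat_adjoin_mult)
  qed
  ultimately show ?thesis by (intro exI[of _ "set Vs"]) auto
qed

text \<open>
  The \<open>d + 1\<close> powers \<open>1, \<theta>, \<dots>, \<theta>\<^sup>d\<close> are linearly dependent over \<open>\<rat>\<close>.
\<close>

lemma has_degree_over_rat_annihilator:
  assumes "has_degree_over_rat L d" and pow: "\<And>i. \<theta> ^ i \<in> L"
  shows "\<exists>g :: rat poly. g \<noteq> 0 \<and> Polynomial.degree g \<le> d \<and> rat_eval \<theta> g = 0"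
proof -
  let ?Us = "map (\<lambda>i. \<theta> ^ i) [0..<Suc d]"
  have "\<not> complex_field.independent \<rat> ?Us"
    using complex_field.independent_length_le_dimension[OF subfield_Rats, of d L ?Us] assms
    unfolding has_degree_over_rat_def by auto
  then obtain Ks where Ks: "set Ks \<subseteq> \<rat>" "complex_field.combine Ks ?Us = 0"
      "\<not> set (take (length ?Us) Ks) \<subseteq> {0}"
    using complex_field.trivial_combine_imp_independent[OF subfield_Rats, of ?Us] by auto
  define m where "m = min (length Ks) (Suc d)"
  have "\<forall>i. \<exists>r. i < length Ks \<longrightarrow> Ks ! i = of_rat r"
    using Ks(1) by (meson Rats_cases nth_mem subsetD)
  then obtain r where r: "\<And>i. i < length Ks \<Longrightarrow> Ks ! i = of_rat (r i)" by metis
  define g where "g = (\<Sum>i<m. Polynomial.monom (r i) i)"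
  have cg: "Polynomial.coeff g i = (if i < m then r i else 0)" for i
    by (auto simp: g_def coeff_sum)
  obtain k where "k \<in> set (take (Suc d) Ks)" "k \<noteq> 0" using Ks(3) by auto
  then obtain i where i: "i < m" "Ks ! i \<noteq> 0"
    by (auto simp: in_set_conv_nth m_def)
  then have "Polynomial.coeff g i \<noteq> 0" using r[of i] by (auto simp: cg m_def)
  then have "g \<noteq> 0" by auto
  moreover have "Polynomial.degree g \<le> d" by (rule degree_le) (auto simp: cg m_def)
  moreover have "rat_eval \<theta> g = 0"
  proof -
    interpret comm_ring_hom "rat_eval \<theta>" by (rule rat_eval_hom)
    have "rat_eval \<theta> g = (\<Sum>i<m. of_rat (r i) * \<theta> ^ i)"
      unfolding g_def hom_sum
      by (simp add: map_poly_monom poly_monom)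
    also have "\<dots> = complex_field.combine Ks ?Us"
      unfolding complex_field_combine by (intro sum.cong) (auto simp: m_def r simp del: upt_Suc)
    finally show ?thesis using Ks(2) by simp
  qed
  ultimately show ?thesis by blast
qed

lemma irreducible_factor_root:
  fixes g :: "rat poly"
  assumes "g \<noteq> 0" "rat_eval \<theta> g = 0"
  shows "\<exists>f. Factorial_Ring.irreducible f \<and> rat_eval \<theta> f = 0 \<and> Polynomial.degree f \<le> Polynomial.degree g"
proof -
  have "algebraic \<theta>"
    by (rule algebraicI'[of "map_poly of_rat g"]) (use assms in \<open>auto simp: coeff_map_poly\<close>)
  then obtain f :: "rat poly" where f: "Factorial_Ring.irreducible f" "rat_eval \<theta> f = 0"
    using irreducible_rat_poly_exists by blast
  then have "f dvd g" using assms irreducible_rat_poly_dvd by blast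
  then show ?thesis using f assms dvd_imp_degree_le by blast
qed

lemma adjoin_primitive_element:
  assumes "has_degree_over_rat (adjoin K \<alpha>) d"
  shows "\<exists>\<theta> f. Factorial_Ring.irreducible f \<and> rat_eval \<theta> f = 0 \<and> Polynomial.degree f \<le> d \<and>
    K \<subseteq> rat_adjoin \<theta> \<and> \<alpha> \<in> rat_adjoin \<theta>"
proof -
  let ?L = "adjoin K \<alpha>"
  have L: "insert \<alpha> K \<subseteq> ?L" "0 \<in> ?L" "1 \<in> ?L"
    using field.zero_in_generate[OF field_from_type_algebra, of "insert \<alpha> K"]
      generate_field.one[of complex_field "insert \<alpha> K"]
    by (auto simp: adjoin_def intro: generate_field.incl)
  have add: "x + y \<in> ?L" and mult: "x * y \<in> ?L" if "x \<in> ?L" "y \<in> ?L" for x y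
    using generate_field.eng_add[of x complex_field "insert \<alpha> K" y]
      generate_field.eng_mult[of x complex_field "insert \<alpha> K" y] that
    by (auto simp: adjoin_def)
  have pow: "x ^ i \<in> ?L" if "x \<in> ?L" for x i
    by (induction i) (use that L mult in auto)
  have ann: "\<exists>f. Factorial_Ring.irreducible f \<and> rat_eval x f = 0 \<and> Polynomial.degree f \<le> d"
    if x: "x \<in> ?L" for x
  proof -
    obtain g :: "rat poly" where "g \<noteq> 0" "Polynomial.degree g \<le> d" "rat_eval x g = 0"
      using has_degree_over_rat_annihilator[OF assms, of x] pow[OF x] by blast
    then show ?thesis using irreducible_factor_root[of g x] by (meson le_trans)
  qed
  have alg: "algebraic x" if x: "x \<in> ?L" for x
  proof -
    obtain f where "Factorial_Ring.irreducible f" "rat_eval x f = 0" using ann[OF x] by blast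
    then show ?thesis
      by (intro algebraicI'[of "map_poly of_rat f"]) (auto simp: coeff_map_poly)
  qed
  obtain B where B: "finite B" "B \<subseteq> ?L" "\<And>\<theta>. B \<subseteq> rat_adjoin \<theta> \<Longrightarrow> ?L \<subseteq> rat_adjoin \<theta>"
    using has_degree_over_rat_spanning[OF assms] by blast
  obtain \<theta> where \<theta>: "\<theta> \<in> ?L" "B \<subseteq> rat_adjoin \<theta>"
    using primitive_element_finite[OF alg L(2) add B(1,2)] by blast
  then show ?thesis using ann[OF \<theta>(1)] B(3)[OF \<theta>(2)] L(1) by blast
qed

section \<open>Hermite's functional\<close>

text \<open>
  This is the integral of \<open>f(t) e\<^bsup>-t\<^esup>\<close> over \<open>t \<ge> 0\<close>; equivalently, it is the sum of
  all derivatives of \<open>f\<close> at \<open>0\<close>.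
\<close>

definition laplace :: "complex poly \<Rightarrow> complex" where
  "laplace f = (\<Sum>i\<le>Polynomial.degree f. fact i * Polynomial.coeff f i)"

lemma laplace_eq_sum:
  assumes "Polynomial.degree f \<le> N"
  shows "laplace f = (\<Sum>i\<le>N. fact i * Polynomial.coeff f i)"
  unfolding laplace_def
  by (rule sum.mono_neutral_left) (use assms in \<open>auto simp: coeff_eq_0\<close>)

lemma laplace_add: "laplace (f + g) = laplace f + laplace g"
proof -
  let ?N = "max (Polynomial.degree f) (Polynomial.degree g)"
  have "Polynomial.degree (f + g) \<le> ?N" by (rule degree_add_le) auto
  then show ?thesis
    by (simp add: laplace_eq_sum[of _ ?N] sum.distrib algebra_simps)
qed

lemma laplace_smult: "laplace (Polynomial.smult c f) = c * laplace f"
  by (cases "c = 0") (simp_all add: laplace_def sum_distrib_left mult_ac)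

lemma laplace_0 [simp]: "laplace 0 = 0"
  by (simp add: laplace_def)

text \<open>
  Integration by parts.
\<close>

lemma laplace_pderiv: "laplace f = Polynomial.coeff f 0 + laplace (pderiv f)"
proof -
  let ?N = "Polynomial.degree f"
  have "laplace f = (\<Sum>i\<le>Suc ?N. fact i * Polynomial.coeff f i)"
    by (rule laplace_eq_sum) simp
  also have "\<dots> = Polynomial.coeff f 0 + (\<Sum>i\<le>?N. fact (Suc i) * Polynomial.coeff f (Suc i))"
    by (subst sum.atMost_Suc_shift) simp
  also have "(\<Sum>i\<le>?N. fact (Suc i) * Polynomial.coeff f (Suc i)) = laplace (pderiv f)"
    by (subst laplace_eq_sum[of _ ?N]) (auto simp: coeff_pderiv degree_pderiv intro!: sum.cong)
  finally show ?thesis .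
qed

definition hermite_functional ::
    "'i set \<Rightarrow> ('i \<Rightarrow> complex) \<Rightarrow> ('i \<Rightarrow> complex) \<Rightarrow> complex poly \<Rightarrow> complex" where
  "hermite_functional J x c g = (\<Sum>j\<in>J. c j * laplace (pcompose g [:x j, 1:]))"

lemma hermite_functional_add:
  "hermite_functional J x c (f + g) = hermite_functional J x c f + hermite_functional J x c g"
  by (simp add: hermite_functional_def pcompose_add laplace_add sum.distrib distrib_left)

lemma hermite_functional_smult:
  "hermite_functional J x c (Polynomial.smult a f) = a * hermite_functional J x c f"
  by (simp add: hermite_functional_def pcompose_smult laplace_smult sum_distrib_left mult_ac)

lemma hermite_functional_0 [simp]: "hermite_functional J x c 0 = 0"
  by (simp add: hermite_functional_def)

lemma hermite_functional_sum:
  "hermite_functional J x c (\<Sum>i\<in>I. f i) = (\<Sum>i\<in>I. hermite_functional J x c (f i))"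
  by (induction I rule: infinite_finite_induct) (simp_all add: hermite_functional_add)

lemma hermite_functional_pderiv:
  "hermite_functional J x c g = (\<Sum>j\<in>J. c j * poly g (x j)) + hermite_functional J x c (pderiv g)"
proof -
  have "laplace (pcompose g [:x j, 1:]) = poly g (x j) + laplace (pcompose (pderiv g) [:x j, 1:])" for j
    by (subst laplace_pderiv) (simp add: pderiv_pcompose pderiv_pCons poly_pcompose flip: poly_0_coeff_0)
  then show ?thesis
    by (simp add: hermite_functional_def sum.distrib distrib_left)
qed

text \<open>
  The non-vanishing part of Hermite's method. Write \<open>w\<close> for the product of all \<open>X - x\<^sub>j\<close> and \<open>v\<^sub>k\<close>
  for the product without the factor \<open>X - x\<^sub>k\<close>. By hypothesis the functional \<open>G\<close> vanishes on all
  \<open>w\<^bsup>n-1\<^esup> v\<^sub>k\<close>. Integration by parts gives \<open>G(h) = G(h')\<close> whenever \<open>h\<close> vanishes at all \<open>x\<^sub>j\<close>.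
  Since the \<open>v\<^sub>k\<close> span the polynomials of degree less than that of \<open>w\<close>, this rule applied to
  \<open>w\<^sup>n q\<close> propagates the vanishing to all multiples of \<open>w\<^bsup>n-1\<^esup>\<close>, and then, as \<open>w\<close> and its derivative
  are coprime, to all multiples of \<open>w\<^bsup>n-2\<^esup>\<close>, and so on down to all polynomials. Finally
  \<open>G(h) - G(h') = 0\<close> for all \<open>h\<close> says that the \<open>c\<^sub>j\<close> annihilate all values \<open>h(x\<^sub>j)\<close>.
\<close>

lemma hermite_functional_nondegenerate:
  fixes x c :: "'i \<Rightarrow> complex"
  assumes J: "finite J" "inj_on x J" and n: "n \<ge> 1"
    and zero: "\<And>k. k \<in> J \<Longrightarrow>
      hermite_functional J x c ((\<Prod>j\<in>J. [:- x j, 1:]) ^ (n - 1) * (\<Prod>j\<in>J - {k}. [:- x j, 1:])) = 0"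
    and i: "i \<in> J"
  shows "c i = 0"
proof -
  define w where "w = (\<Prod>j\<in>J. [:- x j, 1:])"
  define v where "v k = (\<Prod>j\<in>J - {k}. [:- x j, 1:])" for k
  let ?G = "hermite_functional J x c"
  have wv: "w = [:- x k, 1:] * v k" if "k \<in> J" for k
    unfolding w_def v_def using J(1) that by (rule prod.remove)
  have w0: "w \<noteq> 0" using J by (auto simp: w_def)
  have dw: "Polynomial.degree w = card J"
    unfolding w_def by (subst degree_prod_eq_sum_degree) auto
  have dv: "Polynomial.degree (v k) = card J - 1" if "k \<in> J" for k
    using J that unfolding v_def by (subst degree_prod_eq_sum_degree) auto
  have J0: "card J > 0" using i J by (auto simp: card_gt_0_iff)
  have vx: "poly (v k) (x j) = 0" if "k \<in> J" "j \<in> J" "j \<noteq> k" for j k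
    using J that by (auto simp: v_def poly_prod)
  have vk: "poly (v k) (x k) \<noteq> 0" if "k \<in> J" for k
    using J that by (auto simp: v_def poly_prod inj_on_def)
  have wx: "poly w (x j) = 0" if "j \<in> J" for j using wv[OF that] by simp
  have dwx: "poly (pderiv w) (x j) = poly (v j) (x j)" if "j \<in> J" for j
    by (subst wv[OF that], subst pderiv_mult) (simp add: pderiv_pCons)
  \<comment> \<open>partial integration against a multiple of \<open>w\<close>, where the boundary terms vanish\<close>
  have part: "?G (w ^ Suc e * q) = ?G (w ^ e * (Polynomial.smult (of_nat (Suc e)) (pderiv w * q) + w * pderiv q))"
    for e q
  proof -
    have "pderiv (w ^ Suc e * q) = w ^ e * (Polynomial.smult (of_nat (Suc e)) (pderiv w * q) + w * pderiv q)"
      unfolding pderiv_mult pderiv_power_Suc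
      by (simp add: algebra_simps smult_add_right del: of_nat_Suc)
    then show ?thesis
      using hermite_functional_pderiv[of J x c "w ^ Suc e * q"] by (simp add: wx)
  qed
  \<comment> \<open>Lagrange interpolation in the basis of the \<open>v k\<close>.\<close>
  have low: "?G (w ^ (n - 1) * r) = 0" if "Polynomial.degree r < card J" for r
  proof -
    define s where "s = (\<Sum>k\<in>J. Polynomial.smult (poly r (x k) / poly (v k) (x k)) (v k))"
    have "r = s"
    proof (rule poly_eqI_degree[where A = "x ` J"])
      fix z assume "z \<in> x ` J"
      then obtain j where j: "j \<in> J" "z = x j" by auto
      have "poly s (x j) = (\<Sum>k\<in>J. if k = j then poly r (x j) else 0)"
        unfolding s_def poly_sum by (intro sum.cong) (use j vx vk in auto)
      then show "poly r z = poly s z" using j J by simp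
    next
      show "Polynomial.degree r < card (x ` J)" using that J by (simp add: card_image)
      have "Polynomial.degree s \<le> card J - 1"
        unfolding s_def by (intro degree_sum_le J) (use dv degree_smult_le in auto)
      then show "Polynomial.degree s < card (x ` J)" using J0 J by (simp add: card_image)
    qed
    then have "?G (w ^ (n - 1) * r) = ?G (w ^ (n - 1) * s)" by (rule arg_cong)
    also have "\<dots> = (\<Sum>k\<in>J. poly r (x k) / poly (v k) (x k) * ?G (w ^ (n - 1) * v k))"
      by (simp add: s_def sum_distrib_left hermite_functional_sum hermite_functional_smult)
    also have "\<dots> = 0" using zero by (simp add: w_def v_def)
    finally show ?thesis .
  qed
  have top: "?G (w ^ (n - 1) * R) = 0" for R
  proof (induction "Polynomial.degree R" arbitrary: R rule: less_induct)
    case less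
    define q r where "q = R div w" and "r = R mod w"
    have R: "R = w * q + r" by (simp add: q_def r_def)
    have r: "Polynomial.degree r < card J"
      using degree_mod_less[OF w0, of R] J0 dw by (auto simp: r_def)
    have "?G (w ^ (n - 1) * (w * q)) = 0"
    proof (cases "q = 0")
      case False
      have dR: "Polynomial.degree R = card J + Polynomial.degree q"
      proof -
        have "Polynomial.degree (w * q) = card J + Polynomial.degree q"
          using w0 False by (simp add: degree_mult_eq dw)
        then show ?thesis unfolding R using r by (subst degree_add_eq_left) auto
      qed
      let ?R = "Polynomial.smult (of_nat (Suc (n - 1))) (pderiv w * q) + w * pderiv q"
      have "Polynomial.degree (pderiv w * q) \<le> card J - 1 + Polynomial.degree q"
        using degree_mult_le[of "pderiv w" q] by (simp add: degree_pderiv dw)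
      moreover have "Polynomial.degree (w * pderiv q) < card J + Polynomial.degree q"
      proof (cases "pderiv q = 0")
        case False
        then have "Polynomial.degree q > 0" by (metis gr0I pderiv_eq_0_iff)
        then show ?thesis
          using degree_mult_le[of w "pderiv q"] by (simp add: degree_pderiv dw)
      qed (use J0 in auto)
      ultimately have "Polynomial.degree ?R < Polynomial.degree R"
        using J0 dR degree_smult_le[of "of_nat (Suc (n - 1))" "pderiv w * q"]
        by (intro degree_add_less) auto
      from less.hyps[OF this] have "?G (w ^ Suc (n - 1) * q) = 0" by (simp only: part)
      then show ?thesis by (simp add: mult_ac)
    qed simp
    then show ?case using low[OF r] by (subst R) (simp add: distrib_left hermite_functional_add)
  qed
  \<comment> \<open>A common root would be one of the nodes, all of which are simple roots of \<open>w\<close>.\<close>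
  have "Rings.coprime w (pderiv w)"
  proof (rule ccontr)
    assume "\<not> Rings.coprime w (pderiv w)"
    then obtain h where h: "h dvd w" "h dvd pderiv w" "\<not> is_unit h" by (auto simp: coprime_def)
    have "h \<noteq> 0" using h w0 by auto
    then have "Polynomial.degree h \<noteq> 0" using h(3) by (simp add: is_unit_iff_degree)
    then obtain z where z: "poly h z = 0"
      using fundamental_theorem_of_algebra constant_degree by metis
    then have "poly w z = 0" "poly (pderiv w) z = 0"
      using h by (auto elim!: dvdE)
    then obtain j where "j \<in> J" "z = x j" using J by (auto simp: w_def poly_prod)
    then show False using \<open>poly (pderiv w) z = 0\<close> dwx vk by auto
  qed
  then obtain a b where ab: "a * w + b * pderiv w = 1"
    using bezout_coefficients_fst_snd[of w "pderiv w"] by (metis coprime_iff_gcd_eq_1)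
  have descend: "?G (w ^ e * R) = 0" if "\<And>R. ?G (w ^ Suc e * R) = 0" for e R
  proof -
    have "w ^ e * R = w ^ e * ((a * w + b * pderiv w) * R)" by (simp add: ab)
    also have "\<dots> = w ^ Suc e * (a * R) + w ^ e * (pderiv w * (b * R))"
      by (simp add: algebra_simps)
    finally have *: "?G (w ^ e * R) = ?G (w ^ e * (pderiv w * (b * R)))"
      by (simp only: hermite_functional_add that) simp
    have "0 = ?G (w ^ Suc e * (b * R))" using that by simp
    also have "\<dots> = of_nat (Suc e) * ?G (w ^ e * (pderiv w * (b * R))) + ?G (w ^ Suc e * pderiv (b * R))"
      by (subst part) (simp add: distrib_left hermite_functional_add hermite_functional_smult mult_ac del: of_nat_Suc)
    also have "\<dots> = of_nat (Suc e) * ?G (w ^ e * R)" using that by (simp add: *)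
    finally show ?thesis by (simp del: of_nat_Suc)
  qed
  have all: "?G (w ^ e * R) = 0" if "e \<le> n - 1" for e R
    using that by (induction arbitrary: R rule: inc_induct) (use top descend in blast)+
  have "(\<Sum>j\<in>J. c j * poly (v i) (x j)) = 0"
    using hermite_functional_pderiv[of J x c "v i"] all[of 0 "v i"] all[of 0 "pderiv (v i)"] by simp
  also have "(\<Sum>j\<in>J. c j * poly (v i) (x j)) = (\<Sum>j\<in>J. if j = i then c i * poly (v i) (x i) else 0)"
    by (intro sum.cong) (use vx i in auto)
  finally show ?thesis using vk[OF i] i J by simp
qed

section \<open>Simultaneous approximations to powers of the exponential\<close>

text \<open>
  The length of a polynomial with weight \<open>R\<close>, which is submultiplicative.
\<close>

definition coeff_norm :: "real \<Rightarrow> complex poly \<Rightarrow> real" where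
  "coeff_norm R f = poly (map_poly norm f) R"

lemma poly_mono_coeff:
  fixes A B :: "real poly"
  assumes "\<And>i. Polynomial.coeff A i \<le> Polynomial.coeff B i" "0 \<le> R"
  shows "poly A R \<le> poly B R"
proof -
  have "0 \<le> poly (B - A) R"
    unfolding poly_altdef using assms by (intro sum_nonneg mult_nonneg_nonneg) auto
  then show ?thesis by simp
qed

lemma coeff_norm_mult:
  assumes "0 \<le> R" shows "coeff_norm R (f * g) \<le> coeff_norm R f * coeff_norm R g"
  unfolding coeff_norm_def poly_mult[symmetric]
proof (rule poly_mono_coeff[OF _ assms])
  fix i
  have "norm (\<Sum>k\<le>i. Polynomial.coeff f k * Polynomial.coeff g (i - k))
    \<le> (\<Sum>k\<le>i. norm (Polynomial.coeff f k) * norm (Polynomial.coeff g (i - k)))"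
    by (rule order_trans[OF norm_sum]) (simp add: norm_mult)
  then show "Polynomial.coeff (map_poly norm (f * g)) i \<le> Polynomial.coeff (map_poly norm f * map_poly norm g) i"
    by (simp add: coeff_map_poly coeff_mult)
qed

lemma coeff_norm_nonneg: "0 \<le> R \<Longrightarrow> 0 \<le> coeff_norm R f"
  unfolding coeff_norm_def poly_altdef by (intro sum_nonneg) (auto simp: coeff_map_poly)

lemma coeff_norm_1 [simp]: "coeff_norm R 1 = 1"
  by (simp add: coeff_norm_def)

lemma coeff_norm_linear: "coeff_norm R [:a, 1:] = norm a + R"
proof -
  have "map_poly norm [:a, 1:] = [:norm a, 1:]"
    by (intro poly_eqI) (simp add: coeff_map_poly coeff_pCons split: nat.split)
  then show ?thesis by (simp add: coeff_norm_def)
qed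

lemma coeff_norm_power: "0 \<le> R \<Longrightarrow> coeff_norm R (f ^ n) \<le> coeff_norm R f ^ n"
proof (induction n)
  case (Suc n)
  then show ?case
    using order_trans[OF coeff_norm_mult mult_left_mono[OF Suc.IH coeff_norm_nonneg]]
    by simp
qed simp

lemma coeff_norm_prod:
  "0 \<le> R \<Longrightarrow> coeff_norm R (\<Prod>i\<in>I. f i) \<le> (\<Prod>i\<in>I. coeff_norm R (f i))"
proof (induction I rule: infinite_finite_induct)
  case (insert i I)
  then show ?case
    using order_trans[OF coeff_norm_mult mult_left_mono[OF insert.IH coeff_norm_nonneg]]
    by simp
qed simp_all

lemma coeff_norm_eq_sum:
  "coeff_norm R f = (\<Sum>i\<le>Polynomial.degree f. norm (Polynomial.coeff f i) * R ^ i)"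
  by (simp add: coeff_norm_def poly_altdef coeff_map_poly degree_map_poly)

lemma norm_laplace_le:
  assumes "Polynomial.degree f \<le> N"
  shows "norm (laplace f) \<le> fact N * coeff_norm 1 f"
proof -
  have "norm (laplace f) \<le> (\<Sum>i\<le>Polynomial.degree f. fact i * norm (Polynomial.coeff f i))"
    unfolding laplace_def by (rule order_trans[OF norm_sum]) (simp add: norm_mult)
  also have "\<dots> \<le> (\<Sum>i\<le>Polynomial.degree f. fact N * norm (Polynomial.coeff f i))"
    using assms by (intro sum_mono mult_right_mono fact_mono) auto
  finally show ?thesis by (simp add: coeff_norm_eq_sum sum_distrib_left)
qed

lemma laplace_linear_power:
  "laplace ([:w, 1:] ^ s) = fact s * (\<Sum>r\<le>s. w ^ r / fact r)"
proof (induction s)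
  case 0
  show ?case by (simp add: laplace_def)
next
  case (Suc s)
  have "pderiv ([:w, 1:] ^ Suc s) = Polynomial.smult (of_nat (Suc s)) ([:w, 1:] ^ s)"
    unfolding pderiv_power_Suc by (simp add: pderiv_pCons)
  moreover have "Polynomial.coeff ([:w, 1:] ^ Suc s) 0 = w ^ Suc s"
    by (simp only: coeff_0_power) simp
  ultimately have "laplace ([:w, 1:] ^ Suc s) = w ^ Suc s + of_nat (Suc s) * laplace ([:w, 1:] ^ s)"
    by (subst laplace_pderiv) (simp only: laplace_smult)
  also have "\<dots> = fact (Suc s) * (\<Sum>r\<le>Suc s. w ^ r / fact r)"
  proof -
    have "fact (Suc s) * (\<Sum>r\<le>Suc s. w ^ r / fact r) = fact (Suc s) * (\<Sum>r\<le>s. w ^ r / fact r) + w ^ Suc s"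
      by (simp add: distrib_left del: fact_Suc power_Suc)
    then show ?thesis unfolding Suc.IH by (simp add: mult_ac del: power_Suc sum.atMost_Suc of_nat_Suc)
  qed
  finally show ?case .
qed

text \<open>
  For \<open>f = X\<^sup>s\<close> the shifted functional is \<open>s!\<close> times the Taylor polynomial of degree \<open>s\<close> of the
  exponential function, so the difference is \<open>s!\<close> times a Taylor remainder; the general case is
  linear. There is no factorial in the bound, although \<open>laplace f\<close> itself has the size of
  \<open>(degree f)!\<close>: this is why the approximations below are good.
\<close>

lemma laplace_shift_approx:
  "norm (exp w * laplace f - laplace (pcompose f [:w, 1:])) \<le> exp (norm w) * norm w * coeff_norm (norm w) f"
proof -
  let ?n = "Polynomial.degree f"
  let ?c = "Polynomial.coeff f"
  have "laplace (pcompose f [:w, 1:]) = (\<Sum>s\<le>?n. ?c s * laplace ([:w, 1:] ^ s))"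
  proof -
    have sum: "laplace (\<Sum>i\<in>I. g i) = (\<Sum>i\<in>I. laplace (g i))" for I and g :: "nat \<Rightarrow> complex poly"
      by (induction I rule: infinite_finite_induct) (simp_all add: laplace_add)
    have "pcompose f [:w, 1:] = (\<Sum>s\<le>?n. Polynomial.smult (?c s) ([:w, 1:] ^ s))"
      by (simp add: pcompose_altdef poly_altdef degree_map_poly coeff_map_poly)
    then show ?thesis by (simp add: sum laplace_smult)
  qed
  then have "exp w * laplace f - laplace (pcompose f [:w, 1:])
    = exp w * (\<Sum>s\<le>?n. fact s * ?c s) - (\<Sum>s\<le>?n. ?c s * (fact s * (\<Sum>r\<le>s. w ^ r / fact r)))"
    by (simp only: laplace_linear_power) (simp add: laplace_def)
  also have "\<dots> = (\<Sum>s\<le>?n. ?c s * (fact s * (exp w - (\<Sum>r\<le>s. w ^ r / fact r))))"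
    unfolding sum_distrib_left[of "exp w"] sum_subtractf[symmetric]
    by (intro sum.cong refl) (simp add: algebra_simps)
  also have "norm \<dots> \<le> (\<Sum>s\<le>?n. norm (?c s) * (exp (norm w) * norm w ^ Suc s))"
  proof (rule sum_norm_le)
    fix s
    have "norm (exp w - (\<Sum>r\<le>s. w ^ r / fact r)) \<le> exp \<bar>Re w\<bar> * norm w ^ Suc s / fact s"
      by (rule Taylor_exp)
    also have "\<dots> \<le> exp (norm w) * norm w ^ Suc s / fact s"
      by (intro divide_right_mono mult_right_mono) (auto simp: abs_Re_le_cmod)
    finally have "fact s * norm (exp w - (\<Sum>r\<le>s. w ^ r / fact r)) \<le> exp (norm w) * norm w ^ Suc s"
      by (simp add: field_simps)
    then show "norm (?c s * (fact s * (exp w - (\<Sum>r\<le>s. w ^ r / fact r))))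
       \<le> norm (?c s) * (exp (norm w) * norm w ^ Suc s)"
      by (simp add: norm_mult mult_left_mono)
  qed
  also have "\<dots> = exp (norm w) * norm w * coeff_norm (norm w) f"
    by (simp add: coeff_norm_eq_sum sum_distrib_left mult_ac)
  finally show ?thesis .
qed

text \<open>
  Hermite's auxiliary polynomial with nodes \<open>0, z, \<dots>, p z\<close>, translated so that the node \<open>j z\<close> lies
  at the origin; all nodes have multiplicity \<open>n\<close>, except for the node \<open>k z\<close>, which has \<open>n - 1\<close>.
  The \<open>p + 1\<close> choices of \<open>k\<close> provide \<open>p + 1\<close> linearly independent approximations. The definition
  is made over an arbitrary commutative ring so that it commutes with the evaluation of rational
  polynomials at the conjugates of a primitive element.
\<close>

definition hermite_poly :: "nat \<Rightarrow> nat \<Rightarrow> nat \<Rightarrow> nat \<Rightarrow> 'a :: comm_ring_1 \<Rightarrow> 'a poly" where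
  "hermite_poly n p k j z =
     (\<Prod>l\<le>p. [:of_int (int j - int l) * z, 1:] ^ (if l = k then n - 1 else n))"

text \<open>
  For \<open>j \<le> p\<close> this is \<open>laplace\<close> of the auxiliary polynomial divided by \<open>(n - 1)!\<close>: as the polynomial
  is divisible by \<open>X\<^bsup>n-1\<^esup>\<close>, the coefficients with \<open>i < n - 1\<close> vanish, and the other divisions of
  factorials are exact. In this form the quotient is visibly an integer polynomial in \<open>z\<close>.
\<close>

definition hermite_num :: "nat \<Rightarrow> nat \<Rightarrow> nat \<Rightarrow> nat \<Rightarrow> 'a :: comm_ring_1 \<Rightarrow> 'a" where
  "hermite_num n p k j z =
     (\<Sum>i\<le>(p + 1) * n. of_nat (fact i div fact (n - 1)) * Polynomial.coeff (hermite_poly n p k j z) i)"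

lemma (in comm_ring_hom) hom_hermite_num:
  "hom (hermite_num n p k j z) = hermite_num n p k j (hom z)"
proof -
  interpret P: map_poly_comm_ring_hom hom ..
  have lin: "map_poly hom [:a, 1:] = [:hom a, 1:]" for a
    by (intro poly_eqI) (simp add: coeff_map_poly coeff_pCons split: nat.split)
  have "map_poly hom (hermite_poly n p k j z) = hermite_poly n p k j (hom z)"
    unfolding hermite_poly_def P.hom_prod P.hom_power lin hom_mult hom_of_int ..
  then have "hom (Polynomial.coeff (hermite_poly n p k j z) i) = Polynomial.coeff (hermite_poly n p k j (hom z)) i" for i
    by (metis coeff_map_poly hom_zero)
  then show ?thesis
    by (simp add: hermite_num_def hom_sum hom_mult hom_of_nat)
qed

lemma degree_hermite_poly:
  fixes z :: complex
  shows "Polynomial.degree (hermite_poly n p k j z) \<le> (p + 1) * n"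
proof -
  have "Polynomial.degree (hermite_poly n p k j z)
    \<le> (\<Sum>l\<le>p. Polynomial.degree ([:of_int (int j - int l) * z, 1:] ^ (if l = k then n - 1 else n)))"
    unfolding hermite_poly_def by (rule degree_prod_sum_le[unfolded o_def]) simp
  also have "\<dots> \<le> (\<Sum>l\<le>p. n)"
    by (intro sum_mono order_trans[OF degree_power_le]) auto
  finally show ?thesis by simp
qed

lemma hermite_poly_shift:
  fixes z :: complex
  shows "hermite_poly n p k j z = pcompose (hermite_poly n p k 0 z) [:of_nat j * z, 1:]"
  unfolding hermite_poly_def pcompose_hom.hom_prod pcompose_hom.hom_power
  by (intro prod.cong refl arg_cong2[where f = power]) (simp add: pcompose_pCons algebra_simps)

lemma hermite_num_eq_laplace:
  fixes z :: complex
  assumes "j \<le> p"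
  shows "fact (n - 1) * hermite_num n p k j z = laplace (hermite_poly n p k j z)"
proof -
  have "Polynomial.monom 1 (n - 1) dvd hermite_poly n p k j z"
  proof -
    have "[:0, 1:] ^ (n - 1) dvd ([:0, 1:] :: complex poly) ^ (if j = k then n - 1 else n)"
      by (rule le_imp_power_dvd) auto
    also have "[:0, 1:] ^ (if j = k then n - 1 else n)
        = [:of_int (int j - int j) * z, 1:] ^ (if j = k then n - 1 else n)" by simp
    also have "\<dots> dvd hermite_poly n p k j z"
      unfolding hermite_poly_def using assms by (intro dvd_prodI) auto
    finally show ?thesis by (simp add: monom_altdef)
  qed
  then have low: "Polynomial.coeff (hermite_poly n p k j z) i = 0" if "i < n - 1" for i
    using that by (auto elim!: dvdE simp: coeff_monom_mult)
  have *: "fact (n - 1) * (of_nat (fact i div fact (n - 1)) * Polynomial.coeff (hermite_poly n p k j z) i)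
      = fact i * Polynomial.coeff (hermite_poly n p k j z) i" for i
  proof (cases "i < n - 1")
    case False
    then have "(fact (n - 1) :: nat) * (fact i div fact (n - 1)) = fact i"
      by (intro dvd_mult_div_cancel fact_dvd) simp
    then have "(fact (n - 1) :: complex) * of_nat (fact i div fact (n - 1)) = fact i"
      by (metis of_nat_fact of_nat_mult)
    then show ?thesis by (simp flip: mult.assoc)
  qed (simp add: low)
  then show ?thesis
    unfolding hermite_num_def laplace_eq_sum[OF degree_hermite_poly] sum_distrib_left
    by (intro sum.cong refl *)
qed

text \<open>
  A crude form of the bound of the multinomial coefficient \<open>(a n)! / n!\<^sup>a\<close> by \<open>a\<^bsup>a n\<^esup>\<close>.
\<close>

lemma fact_mult_le: "fact (a * n) \<le> (real a ^ a) ^ n * fact n ^ a"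
proof (induction n)
  case (Suc n)
  have step: "fact (m + k) \<le> (fact m :: real) * real (m + k) ^ k" for m k
  proof (induction k)
    case (Suc k)
    have "fact (m + Suc k) = real (m + Suc k) * fact (m + k)" by simp
    also have "\<dots> \<le> real (m + Suc k) * (fact m * real (m + k) ^ k)"
      by (intro mult_left_mono Suc.IH) simp
    also have "\<dots> \<le> real (m + Suc k) * (fact m * real (m + Suc k) ^ k)"
      by (intro mult_left_mono power_mono) auto
    finally show ?case by (simp add: mult_ac)
  qed simp
  have "fact (a * Suc n) \<le> (fact (a * n) :: real) * real (a * Suc n) ^ a"
    using step[of "a * n" a] by (simp add: add.commute)
  also have "\<dots> \<le> ((real a ^ a) ^ n * fact n ^ a) * real (a * Suc n) ^ a"
    by (intro mult_right_mono Suc.IH) simp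
  also have "real (a * Suc n) ^ a = real a ^ a * real (Suc n) ^ a"
    by (simp only: of_nat_mult power_mult_distrib)
  finally show ?case
    by (simp add: power_mult_distrib mult_ac del: of_nat_Suc mult_Suc_right)
qed simp

lemma coeff_norm_hermite_poly:
  fixes z :: complex
  assumes "0 \<le> R" "n \<ge> 1"
  shows "coeff_norm R (hermite_poly n p k 0 z) \<le> ((1 + real p * norm z + R) ^ (p + 1)) ^ n"
proof -
  let ?M = "1 + real p * norm z + R"
  have "coeff_norm R (hermite_poly n p k 0 z)
     \<le> (\<Prod>l\<le>p. coeff_norm R ([:of_int (int 0 - int l) * z, 1:] ^ (if l = k then n - 1 else n)))"
    unfolding hermite_poly_def by (rule coeff_norm_prod[OF assms(1)])
  also have "\<dots> \<le> (\<Prod>l\<le>p. ?M ^ n)"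
  proof (intro prod_mono conjI coeff_norm_nonneg assms(1))
    fix l assume "l \<in> {..p}"
    then have "real l * norm z \<le> real p * norm z" by (intro mult_right_mono) auto
    then have *: "coeff_norm R [:of_int (int 0 - int l) * z, 1:] \<le> ?M"
      by (simp add: coeff_norm_linear norm_mult)
    have "coeff_norm R ([:of_int (int 0 - int l) * z, 1:] ^ e) \<le> ?M ^ e" for e
      by (rule order_trans[OF coeff_norm_power[OF assms(1)] power_mono[OF * coeff_norm_nonneg[OF assms(1)]]])
    also have "?M ^ (if l = k then n - 1 else n) \<le> ?M ^ n"
      using assms by (intro power_increasing) auto
    finally show "coeff_norm R ([:of_int (int 0 - int l) * z, 1:] ^ (if l = k then n - 1 else n)) \<le> ?M ^ n" .
  qed
  also have "\<dots> = (?M ^ n) ^ (p + 1)" by simp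
  also have "\<dots> = (?M ^ (p + 1)) ^ n" by (metis power_mult mult.commute)
  finally show ?thesis .
qed

text \<open>
  Up to factors \<open>C\<^sup>n\<close>, with \<open>N = (n - 1)!\<close>: the common denominators have size
  \<open>((p + 1) n)! / N \<approx> N\<^sup>p\<close>, and the errors of approximation have size \<open>1 / N\<close>.
\<close>

lemma hermite_num_bounds:
  fixes z :: complex
  shows "\<exists>C\<ge>1. \<forall>n\<ge>1. \<forall>k. \<forall>j\<le>p.
    norm (hermite_num n p k 0 z) \<le> C ^ n * fact (n - 1) ^ p \<and>
    norm (exp (of_nat j * z) * hermite_num n p k 0 z - hermite_num n p k j z) \<le> C ^ n / fact (n - 1)"
proof -
  define M1 where "M1 = (1 + real p * norm z + 1) ^ (p + 1)"
  define R where "R = real p * norm z"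
  define M2 where "M2 = (1 + real p * norm z + R) ^ (p + 1)"
  define C1 where "C1 = real (p + 1) ^ (p + 1) * 2 ^ (p + 1) * M1"
  define C2 where "C2 = exp R * (1 + R) * M2"
  define C where "C = max 1 (max C1 C2)"
  have pos: "R \<ge> 0" "M1 \<ge> 0" "M2 \<ge> 1" "C \<ge> 1"
  proof -
    show R: "R \<ge> 0" by (simp add: R_def)
    show "M1 \<ge> 0" "C \<ge> 1" by (simp_all add: M1_def C_def)
    show "M2 \<ge> 1" unfolding M2_def by (rule one_le_power) (use R in simp)
  qed
  show ?thesis
  proof (intro exI[of _ C] conjI allI impI)
    fix n k j :: nat assume n: "1 \<le> n" and j: "j \<le> p"
    let ?N = "fact (n - 1) :: real"
    have N: "?N \<ge> 1" by (rule fact_ge_1)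
    have nN: "fact n \<le> 2 ^ n * ?N"
    proof -
      have "fact n = real n * ?N" using n by (simp add: fact_reduce)
      also have "real n \<le> 2 ^ n" using less_exp[of n] by (simp add: of_nat_less_two_power less_imp_le)
      finally show ?thesis by (simp add: mult_right_mono)
    qed
    have "?N * norm (hermite_num n p k 0 z) = norm (laplace (hermite_poly n p k 0 z))"
      using hermite_num_eq_laplace[of 0 p n k z] by (simp add: norm_mult flip: hermite_num_eq_laplace)
    also have "\<dots> \<le> fact ((p + 1) * n) * coeff_norm 1 (hermite_poly n p k 0 z)"
      by (rule norm_laplace_le[OF degree_hermite_poly])
    also have "\<dots> \<le> ((real (p + 1) ^ (p + 1)) ^ n * fact n ^ (p + 1)) * M1 ^ n"
      unfolding M1_def by (intro mult_mono fact_mult_le coeff_norm_hermite_poly n coeff_norm_nonneg) auto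
    also have "\<dots> \<le> ((real (p + 1) ^ (p + 1)) ^ n * (2 ^ n * ?N) ^ (p + 1)) * M1 ^ n"
      using pos by (intro mult_right_mono mult_left_mono power_mono nN) auto
    also have "\<dots> = C1 ^ n * ?N ^ (p + 1)"
      by (simp add: C1_def power_mult_distrib mult_ac flip: power_mult)
    also have "\<dots> \<le> C ^ n * ?N ^ (p + 1)"
      using pos by (intro mult_right_mono power_mono) (auto simp: C_def C1_def)
    finally show "norm (hermite_num n p k 0 z) \<le> C ^ n * ?N ^ p"
      using N by (simp add: field_simps)
    let ?w = "of_nat j * z"
    have w: "norm ?w \<le> R" using j by (simp add: R_def norm_mult mult_right_mono)
    have "?N * norm (exp ?w * hermite_num n p k 0 z - hermite_num n p k j z)
      = norm (fact (n - 1) * (exp ?w * hermite_num n p k 0 z - hermite_num n p k j z))"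
      by (simp add: norm_mult)
    also have "\<dots> = norm (exp ?w * (fact (n - 1) * hermite_num n p k 0 z) - fact (n - 1) * hermite_num n p k j z)"
      by (simp add: algebra_simps)
    also have "\<dots> = norm (exp ?w * laplace (hermite_poly n p k 0 z)
        - laplace (pcompose (hermite_poly n p k 0 z) [:?w, 1:]))"
      using j by (simp only: hermite_num_eq_laplace le0 hermite_poly_shift[of n p k j])
    also have "\<dots> \<le> exp (norm ?w) * norm ?w * coeff_norm (norm ?w) (hermite_poly n p k 0 z)"
      by (rule laplace_shift_approx)
    also have "\<dots> \<le> exp R * R * M2 ^ n"
    proof (intro mult_mono)
      have "coeff_norm (norm ?w) (hermite_poly n p k 0 z) \<le> ((1 + real p * norm z + norm ?w) ^ (p + 1)) ^ n"
        by (rule coeff_norm_hermite_poly) (use n in auto)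
      also have "\<dots> \<le> M2 ^ n" unfolding M2_def using w by (intro power_mono) auto
      finally show "coeff_norm (norm ?w) (hermite_poly n p k 0 z) \<le> M2 ^ n" .
    qed (use w pos in \<open>auto intro: coeff_norm_nonneg\<close>)
    also have "\<dots> \<le> (exp R * (1 + R)) * M2 ^ n"
      using pos by (intro mult_right_mono mult_left_mono) auto
    also have "\<dots> \<le> (exp R * (1 + R)) ^ n * M2 ^ n"
    proof (intro mult_right_mono)
      have "1 * 1 \<le> exp R * (1 + R)" using pos by (intro mult_mono) auto
      then show "exp R * (1 + R) \<le> (exp R * (1 + R)) ^ n"
        using n by (intro self_le_power) auto
    qed (use pos in auto)
    also have "\<dots> = C2 ^ n" by (simp add: C2_def power_mult_distrib)
    also have "\<dots> \<le> C ^ n" using pos by (intro power_mono) (auto simp: C_def C2_def)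
    finally show "norm (exp ?w * hermite_num n p k 0 z - hermite_num n p k j z) \<le> C ^ n / ?N"
      using N by (simp add: field_simps)
  qed (use pos in auto)
qed

text \<open>
  The auxiliary polynomial has at most \<open>(p + 1) n\<close> linear factors, and each of them becomes integral
  when it is multiplied by \<open>D\<close>.
\<close>

lemma algebraic_int_hermite_num:
  fixes z :: complex
  assumes D: "algebraic_int (of_nat D * z)"
  shows "algebraic_int (of_nat D ^ ((p + 1) * n) * hermite_num n p k j z)"
proof -
  let ?int = "\<lambda>f :: complex poly. \<forall>i. algebraic_int (Polynomial.coeff f i)"
  have mult: "?int (f * g)" if "?int f" "?int g" for f g
    using that unfolding coeff_mult by (intro allI algebraic_int_sum_complex algebraic_int_mult) auto
  have one: "?int 1" by (auto intro: int_imp_algebraic_int)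
  have pow: "?int (f ^ e)" if "?int f" for f e
    by (induction e) (use that mult one in auto)
  have prod: "?int (\<Prod>i\<in>I. f i)" if "\<And>i. i \<in> I \<Longrightarrow> ?int (f i)" for I and f :: "nat \<Rightarrow> complex poly"
    using that by (induction I rule: infinite_finite_induct) (use mult one in auto)
  let ?e = "\<lambda>l. if l = k then n - 1 else n"
  have fac: "?int (Polynomial.smult (of_nat D ^ n) ([:of_int (int j - int l) * z, 1:] ^ ?e l))" for l
  proof -
    have eq: "Polynomial.smult (of_nat D ^ n) ([:of_int (int j - int l) * z, 1:] ^ ?e l)
      = [:of_nat D ^ (n - ?e l):] * (Polynomial.smult (of_nat D) [:of_int (int j - int l) * z, 1:]) ^ ?e l"
    proof -
      have "Polynomial.smult (c ^ n) (y ^ e) = [:c ^ (n - e):] * Polynomial.smult c y ^ e"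
        if "e \<le> n" for c :: complex and y e
        using that by (simp add: smult_power flip: power_add)
      then show ?thesis by auto
    qed
    have c: "?int [:of_nat D ^ (n - ?e l):]"
      by (auto simp: coeff_pCons intro: int_imp_algebraic_int split: nat.split)
    have "algebraic_int (of_int (int j - int l) * (of_nat D * z))"
      by (rule algebraic_int_mult[OF _ D]) (auto intro: int_imp_algebraic_int)
    then have "?int (Polynomial.smult (of_nat D) [:of_int (int j - int l) * z, 1:])"
      by (auto simp: coeff_pCons mult_ac intro: int_imp_algebraic_int split: nat.split)
    then show ?thesis unfolding eq by (intro mult pow c)
  qed
  have "Polynomial.smult (of_nat D ^ ((p + 1) * n)) (hermite_poly n p k j z)
     = (\<Prod>l\<le>p. Polynomial.smult (of_nat D ^ n) ([:of_int (int j - int l) * z, 1:] ^ ?e l))"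
  proof -
    have "(\<Prod>l\<in>I. Polynomial.smult c (f l)) = Polynomial.smult (c ^ card I) (\<Prod>l\<in>I. f l)"
      if "finite I" for I c and f :: "nat \<Rightarrow> complex poly"
      using that by induction (auto simp: mult_ac)
    then show ?thesis by (simp add: hermite_poly_def mult.commute power_add flip: power_mult)
  qed
  then have "?int (Polynomial.smult (of_nat D ^ ((p + 1) * n)) (hermite_poly n p k j z))"
    using prod fac by simp
  then have int: "algebraic_int (of_nat D ^ ((p + 1) * n) * Polynomial.coeff (hermite_poly n p k j z) i)" for i
    by simp
  have "of_nat D ^ ((p + 1) * n) * hermite_num n p k j z = (\<Sum>i\<le>(p + 1) * n.
      of_nat (fact i div fact (n - 1)) * (of_nat D ^ ((p + 1) * n) * Polynomial.coeff (hermite_poly n p k j z) i))"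
    by (simp add: hermite_num_def sum_distrib_left mult_ac)
  also have "algebraic_int \<dots>"
    by (intro algebraic_int_sum_complex algebraic_int_mult int) (auto intro: int_imp_algebraic_int)
  finally show ?thesis .
qed

lemma hermite_num_nondegenerate:
  fixes z :: complex
  assumes z: "z \<noteq> 0" and n: "n \<ge> 1"
    and zero: "\<And>k. k \<le> p \<Longrightarrow> (\<Sum>j\<le>p. c j * hermite_num n p k j z) = 0"
    and j: "j \<le> p"
  shows "c j = 0"
proof (rule hermite_functional_nondegenerate[of "{..p}" "\<lambda>j. of_nat j * z" n c])
  show "inj_on (\<lambda>j. of_nat j * z) {..p}" using z by (auto simp: inj_on_def)
  fix k assume k: "k \<in> {..p}"
  have "hermite_poly n p k 0 z
      = (\<Prod>l\<le>p. [:- (of_nat l * z), 1:] ^ (n - 1) * (if l = k then 1 else [:- (of_nat l * z), 1:]))"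
    unfolding hermite_poly_def
  proof (intro prod.cong refl)
    fix l
    have "y ^ (if l = k then n - 1 else n) = y ^ (n - 1) * (if l = k then 1 else y)" for y :: "complex poly"
      using n power_minus_mult[of n y] by auto
    moreover have "of_int (int 0 - int l) * z = - (of_nat l * z)" by simp
    ultimately show "[:of_int (int 0 - int l) * z, 1:] ^ (if l = k then n - 1 else n)
        = [:- (of_nat l * z), 1:] ^ (n - 1) * (if l = k then 1 else [:- (of_nat l * z), 1:])"
      by (simp only:)
  qed
  also have "\<dots> = (\<Prod>l\<le>p. [:- (of_nat l * z), 1:]) ^ (n - 1) * (\<Prod>l\<in>{..p} - {k}. [:- (of_nat l * z), 1:])"
  proof -
    have "(\<Prod>l\<le>p. if l = k then 1 else [:- (of_nat l * z), 1:]) = (\<Prod>l\<in>{..p} - {k}. [:- (of_nat l * z), 1:])"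
      by (rule prod.mono_neutral_cong_right) auto
    then show ?thesis by (simp add: prod.distrib prod_power_distrib)
  qed
  finally have h: "(\<Prod>l\<le>p. [:- (of_nat l * z), 1:]) ^ (n - 1) * (\<Prod>l\<in>{..p} - {k}. [:- (of_nat l * z), 1:])
     = hermite_poly n p k 0 z" by simp
  have "hermite_functional {..p} (\<lambda>j. of_nat j * z) c (hermite_poly n p k 0 z)
      = (\<Sum>j\<le>p. c j * (fact (n - 1) * hermite_num n p k j z))"
    unfolding hermite_functional_def
    by (intro sum.cong refl) (simp only: hermite_num_eq_laplace atMost_iff hermite_poly_shift[symmetric])
  also have "\<dots> = fact (n - 1) * (\<Sum>j\<le>p. c j * hermite_num n p k j z)"
    by (simp add: sum_distrib_left mult_ac)
  also have "\<dots> = 0" using zero k by simp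
  finally show "hermite_functional {..p} (\<lambda>j. of_nat j * z) c
    ((\<Prod>j\<in>{..p}. [:- (of_nat j * z), 1:]) ^ (n - 1) * (\<Prod>j\<in>{..p} - {k}. [:- (of_nat j * z), 1:])) = 0"
    unfolding h .
qed (use j n in auto)

section \<open>The determinant of the approximations\<close>

text \<open>
  A matrix whose rows are linearly independent has a nonzero maximal minor. The columns are chosen
  greedily: expanding along a new last column \<open>k\<close>, the determinant is a linear combination of the
  entries of that column whose coefficients do not depend on \<open>k\<close>, and the last coefficient is the
  nonzero minor found before. So it cannot vanish for all \<open>k\<close>.
\<close>

lemma exists_nonzero_minor:
  fixes V :: "nat \<Rightarrow> 'k \<Rightarrow> 'a :: field"
  assumes indep: "\<And>c i. (\<And>k. k \<in> S \<Longrightarrow> (\<Sum>i<m. c i * V i k) = 0) \<Longrightarrow> i < m \<Longrightarrow> c i = 0"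
  shows "\<exists>\<kappa>. (\<forall>j<m. \<kappa> j \<in> S) \<and> Determinant.det (Matrix.mat m m (\<lambda>(i, j). V i (\<kappa> j))) \<noteq> 0"
proof -
  have "\<exists>\<kappa>. (\<forall>j<r. \<kappa> j \<in> S) \<and> Determinant.det (Matrix.mat r r (\<lambda>(i, j). V i (\<kappa> j))) \<noteq> 0"
    if "r \<le> m" for r
    using that
  proof (induction r)
    case 0
    have "Determinant.det (Matrix.mat 0 0 (\<lambda>(i, j). V i (undefined j))) = 1"
      by (rule det_dim_zero) simp
    then show ?case by auto
  next
    case (Suc r)
    then obtain \<kappa> where \<kappa>: "\<forall>j<r. \<kappa> j \<in> S"
        "Determinant.det (Matrix.mat r r (\<lambda>(i, j). V i (\<kappa> j))) \<noteq> 0" by auto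
    define A where "A k = Matrix.mat (Suc r) (Suc r) (\<lambda>(i, j). V i ((\<kappa>(r := k)) j))" for k
    define D where "D i = Determinant.det (Matrix.mat r r (\<lambda>(i', j). V (if i' < i then i' else Suc i') (\<kappa> j)))" for i
    define c where "c i = (if i < Suc r then (-1) ^ (i + r) * D i else 0)" for i
    have detA: "Determinant.det (A k) = (\<Sum>i<m. c i * V i k)" for k
    proof -
      have A: "A k \<in> carrier_mat (Suc r) (Suc r)" by (simp add: A_def)
      have "mat_delete (A k) i r = Matrix.mat r r (\<lambda>(i', j). V (if i' < i then i' else Suc i') (\<kappa> j))"
        if "i < Suc r" for i
        by (rule eq_matI) (use that in \<open>auto simp: mat_delete_def A_def\<close>)
      then have "cofactor (A k) i r = (-1) ^ (i + r) * D i" if "i < Suc r" for i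
        using that by (simp add: cofactor_def D_def)
      then have "Determinant.det (A k) = (\<Sum>i<Suc r. V i k * ((-1) ^ (i + r) * D i))"
        unfolding laplace_expansion_column[OF A lessI]
        by (intro sum.cong refl) (simp add: A_def)
      also have "\<dots> = (\<Sum>i<Suc r. c i * V i k)"
        by (intro sum.cong) (auto simp: c_def)
      also have "\<dots> = (\<Sum>i<m. c i * V i k)"
        by (rule sum.mono_neutral_left) (use Suc.prems in \<open>auto simp: c_def\<close>)
      finally show ?thesis .
    qed
    have "D r \<noteq> 0"
    proof -
      have "Matrix.mat r r (\<lambda>(i', j). V (if i' < r then i' else Suc i') (\<kappa> j)) = Matrix.mat r r (\<lambda>(i, j). V i (\<kappa> j))"
        by (rule eq_matI) auto
      then show ?thesis using \<kappa>(2) by (simp add: D_def)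
    qed
    then have "c r \<noteq> 0" by (simp add: c_def)
    then obtain k where "k \<in> S" "Determinant.det (A k) \<noteq> 0"
      using indep[of c r] Suc.prems detA by force
    then show ?case using \<kappa>(1)
      by (intro exI[of _ "\<kappa>(r := k)"]) (auto simp: A_def less_Suc_eq)
  qed
  then show ?thesis by blast
qed

lemma norm_det_le:
  fixes A :: "complex mat"
  assumes A: "A \<in> carrier_mat m m"
    and R: "\<And>i j. i < m \<Longrightarrow> j < m \<Longrightarrow> norm (A $$ (i, j)) \<le> R i"
  shows "norm (Determinant.det A) \<le> fact m * (\<Prod>i<m. R i)"
proof -
  have "norm (Determinant.det A) \<le> (\<Sum>\<pi> | \<pi> permutes {0..<m}. \<Prod>i<m. R i)"
    unfolding det_def'[OF A]
  proof (rule sum_norm_le)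
    fix \<pi> assume "\<pi> \<in> {\<pi>. \<pi> permutes {0..<m}}"
    then have \<pi>: "\<pi> permutes {0..<m}" by simp
    have "norm (of_int (sign \<pi>) :: complex) = 1" by (simp add: sign_def)
    then have "norm (of_int (sign \<pi>) * (\<Prod>i = 0..<m. A $$ (i, \<pi> i))) = (\<Prod>i<m. norm (A $$ (i, \<pi> i)))"
      by (simp add: norm_mult prod_norm lessThan_atLeast0)
    also have "\<dots> \<le> (\<Prod>i<m. R i)"
      using permutes_in_image[OF \<pi>] by (intro prod_mono) (auto intro: R)
    finally show "norm (of_int (sign \<pi>) * (\<Prod>i = 0..<m. A $$ (i, \<pi> i))) \<le> (\<Prod>i<m. R i)" .
  qed
  then show ?thesis by (simp add: card_permutations[of _ m])
qed

lemma algebraic_int_det: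
  fixes A :: "complex mat"
  assumes A: "A \<in> carrier_mat m m"
    and int: "\<And>i j. i < m \<Longrightarrow> j < m \<Longrightarrow> algebraic_int (A $$ (i, j))"
  shows "algebraic_int (Determinant.det A)"
  unfolding det_def'[OF A]
proof (intro algebraic_int_sum_complex algebraic_int_mult algebraic_int_prod_complex)
  fix \<pi> i assume "\<pi> \<in> {\<pi>. \<pi> permutes {0..<m}}" "i \<in> {0..<m}"
  then show "algebraic_int (A $$ (i, \<pi> i))"
    using permutes_in_image[of \<pi> "{0..<m}" i] by (intro int) auto
qed (auto intro: int_imp_algebraic_int)

text \<open>
  The values of the \<open>m\<close> linear forms with coefficient vectors \<open>P, X P, \<dots>, X\<^bsup>m-1\<^esup> P\<close>, where \<open>P\<close> has the
  coefficients \<open>a\<close>, at \<open>m\<close> of the \<open>p + 1\<close> vectors of Hermite approximations; \<open>\<kappa>\<close> is the selection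
  of these vectors.
\<close>

definition hermite_mat :: "nat \<Rightarrow> nat \<Rightarrow> nat \<Rightarrow> nat \<Rightarrow> (nat \<Rightarrow> nat) \<Rightarrow> (nat \<Rightarrow> 'a) \<Rightarrow> 'a :: comm_ring_1 \<Rightarrow> 'a mat" where
  "hermite_mat m \<delta> n p \<kappa> a z =
     Matrix.mat m m (\<lambda>(i, j). \<Sum>l\<le>\<delta>. a l * hermite_num n p (\<kappa> j) (l + i) z)"

lemma hermite_mat_carrier [simp]: "hermite_mat m \<delta> n p \<kappa> a z \<in> carrier_mat m m"
  by (simp add: hermite_mat_def)

lemma (in comm_ring_hom) hom_det_hermite_mat:
  "hom (Determinant.det (hermite_mat m \<delta> n p \<kappa> a z)) = Determinant.det (hermite_mat m \<delta> n p \<kappa> (\<lambda>l. hom (a l)) (hom z))"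
proof -
  have "map_mat hom (hermite_mat m \<delta> n p \<kappa> a z) = hermite_mat m \<delta> n p \<kappa> (\<lambda>l. hom (a l)) (hom z)"
    by (rule eq_matI) (auto simp: hermite_mat_def hom_sum hom_mult hom_hermite_num)
  then show ?thesis by (metis hom_det)
qed

lemma algebraic_int_det_hermite_mat:
  fixes z :: complex
  assumes D: "algebraic_int (of_nat D * z)" and a: "\<And>l. algebraic_int (a l)"
  shows "algebraic_int (of_nat D ^ ((p + 1) * n * m) * Determinant.det (hermite_mat m \<delta> n p \<kappa> a z))"
proof -
  let ?c = "of_nat D ^ ((p + 1) * n) :: complex"
  have "Determinant.det (?c \<cdot>\<^sub>m hermite_mat m \<delta> n p \<kappa> a z)
     = ?c ^ m * Determinant.det (hermite_mat m \<delta> n p \<kappa> a z)"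
    by (subst det_smult) (simp add: hermite_mat_def)
  moreover have "algebraic_int (Determinant.det (?c \<cdot>\<^sub>m hermite_mat m \<delta> n p \<kappa> a z))"
  proof (rule algebraic_int_det[of _ m])
    fix i j assume ij: "i < m" "j < m"
    then have "(?c \<cdot>\<^sub>m hermite_mat m \<delta> n p \<kappa> a z) $$ (i, j)
        = (\<Sum>l\<le>\<delta>. a l * (?c * hermite_num n p (\<kappa> j) (l + i) z))"
      by (simp add: hermite_mat_def sum_distrib_left mult_ac)
    also have "algebraic_int \<dots>"
      by (intro algebraic_int_sum_complex algebraic_int_mult[OF a algebraic_int_hermite_num[OF D]])
    finally show "algebraic_int ((?c \<cdot>\<^sub>m hermite_mat m \<delta> n p \<kappa> a z) $$ (i, j))" .
  qed simp
  ultimately show ?thesis by (simp only: power_mult)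
qed

text \<open>
  The \<open>p + 1\<close> vectors of approximations form an invertible matrix, and the forms \<open>X\<^sup>i P\<close> are
  independent because the polynomial ring has no zero divisors.
\<close>

lemma exists_det_hermite_mat_nonzero:
  fixes z :: complex
  assumes z: "z \<noteq> 0" and n: "n \<ge> 1" and m: "m \<ge> 1" and p: "p = \<delta> + m - 1"
    and a: "l0 \<le> \<delta>" "a l0 \<noteq> 0"
  shows "\<exists>\<kappa>. Determinant.det (hermite_mat m \<delta> n p \<kappa> a z) \<noteq> 0"
proof -
  define A where "A = (\<Sum>l\<le>\<delta>. Polynomial.monom (a l) l)"
  have "Polynomial.coeff A l0 = a l0" using a by (simp add: A_def coeff_sum)
  then have A0: "A \<noteq> 0" using a by auto
  have "\<exists>\<kappa>. (\<forall>j<m. \<kappa> j \<in> {..p}) \<and>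
      Determinant.det (Matrix.mat m m (\<lambda>(i, j). \<Sum>l\<le>\<delta>. a l * hermite_num n p (\<kappa> j) (l + i) z)) \<noteq> 0"
  proof (rule exists_nonzero_minor)
    fix c :: "nat \<Rightarrow> complex" and i
    assume zero: "\<And>k. k \<in> {..p} \<Longrightarrow> (\<Sum>i<m. c i * (\<Sum>l\<le>\<delta>. a l * hermite_num n p k (l + i) z)) = 0"
      and i: "i < m"
    \<comment> \<open>A linear relation between the rows with coefficients \<open>c\<close> makes the coefficient vector of \<open>B A\<close> annihilate all vectors of approximations.\<close>
    define B where "B = (\<Sum>i<m. Polynomial.monom (c i) i)"
    have BA: "B * A = (\<Sum>i<m. \<Sum>l\<le>\<delta>. Polynomial.monom (c i * a l) (l + i))"
      by (simp add: A_def B_def sum_product mult_monom add.commute)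
    have "(\<Sum>j\<le>p. Polynomial.coeff (B * A) j * hermite_num n p k j z) = 0" if "k \<le> p" for k
    proof -
      have "(\<Sum>j\<le>p. Polynomial.coeff (B * A) j * hermite_num n p k j z)
         = (\<Sum>i<m. \<Sum>l\<le>\<delta>. \<Sum>j\<le>p. Polynomial.coeff (Polynomial.monom (c i * a l) (l + i)) j * hermite_num n p k j z)"
        unfolding BA coeff_sum sum_distrib_right
        by (subst sum.swap, rule sum.cong[OF refl], rule sum.swap)
      also have "\<dots> = (\<Sum>i<m. \<Sum>l\<le>\<delta>. c i * a l * hermite_num n p k (l + i) z)"
      proof (intro sum.cong refl)
        fix i l assume "i \<in> {..<m}" "l \<in> {..\<delta>}"
        then have "l + i \<le> p" using m by (auto simp: p)
        have "(\<Sum>j\<le>p. Polynomial.coeff (Polynomial.monom (c i * a l) (l + i)) j * hermite_num n p k j z)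
           = (\<Sum>j\<le>p. if j = l + i then c i * a l * hermite_num n p k (l + i) z else 0)"
          by (intro sum.cong) auto
        then show "(\<Sum>j\<le>p. Polynomial.coeff (Polynomial.monom (c i * a l) (l + i)) j * hermite_num n p k j z)
           = c i * a l * hermite_num n p k (l + i) z"
          using \<open>l + i \<le> p\<close> by simp
      qed
      also have "\<dots> = (\<Sum>i<m. c i * (\<Sum>l\<le>\<delta>. a l * hermite_num n p k (l + i) z))"
        by (simp add: sum_distrib_left mult.assoc)
      also have "\<dots> = 0" using zero that by simp
      finally show ?thesis .
    qed
    then have low: "Polynomial.coeff (B * A) j = 0" if "j \<le> p" for j
      using hermite_num_nondegenerate[OF z n, of p "Polynomial.coeff (B * A)"] that by blast
    have "Polynomial.coeff (B * A) j = 0" if "j > p" for j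
      unfolding BA coeff_sum using that m by (intro sum.neutral ballI) (auto simp: p)
    with low have "B * A = 0" by (intro poly_eqI) (metis coeff_0 not_le)
    then have "B = 0" using A0 by simp
    moreover have "Polynomial.coeff B i = c i" using i by (simp add: B_def coeff_sum)
    ultimately show "c i = 0" by simp
  qed
  then show ?thesis unfolding hermite_mat_def by blast
qed

text \<open>
  With \<open>N = (n - 1)!\<close>, the entry \<open>(i, j)\<close> is \<open>e\<^bsup>i z\<^esup> P(e\<^sup>z) q\<^sub>j\<close> plus an error of size \<open>H / N\<close>, where
  \<open>q\<^sub>j\<close> is a common denominator of size \<open>N\<^sup>p\<close>. The main part has rank one, so after row operations only
  the first row is large. Hence the determinant is bounded by
  \<open>(N\<^sup>p |P(e\<^sup>z)| + H / N) (H / N)\<^bsup>m-1\<^esup>\<close> up to \<open>C\<^sup>n\<close>, and \<open>p - (m - 1) = \<delta>\<close>. The bound is used twice: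
  at \<open>z = \<alpha>\<close>, where \<open>P(e\<^sup>\<alpha>)\<close> is supposed to be small, and at the other conjugates, where only the
  trivial estimate of \<open>P(e\<^sup>z)\<close> is available and the cancellation still gives \<open>N\<^sup>\<delta> H\<^sup>m\<close>.
\<close>

lemma norm_det_hermite_mat_le:
  fixes z :: complex
  assumes m: "m \<ge> 1" and p: "p = \<delta> + m - 1"
  shows "\<exists>C\<ge>1. \<forall>n\<ge>1. \<forall>\<kappa> a H. (\<forall>l\<le>\<delta>. norm (a l) \<le> H) \<longrightarrow>
    norm (Determinant.det (hermite_mat m \<delta> n p \<kappa> a z))
      \<le> C ^ n * (norm (\<Sum>l\<le>\<delta>. a l * exp z ^ l) * H ^ (m - 1) * fact (n - 1) ^ \<delta> + (H / fact (n - 1)) ^ m)"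
proof -
  obtain C0 where C0: "C0 \<ge> 1" and bd: "\<And>n k j. 1 \<le> n \<Longrightarrow> j \<le> p \<Longrightarrow>
    norm (hermite_num n p k 0 z) \<le> C0 ^ n * fact (n - 1) ^ p \<and>
    norm (exp (of_nat j * z) * hermite_num n p k 0 z - hermite_num n p k j z) \<le> C0 ^ n / fact (n - 1)"
    using hermite_num_bounds[of p z] by blast
  define K where "K = real (\<delta> + 1) * (1 + exp (real m * norm z))"
  have "1 * 1 \<le> K" unfolding K_def by (intro mult_mono) auto
  then have K1: "K \<ge> 1" by simp
  define C where "C = fact m * K ^ m * C0 ^ m"
  have fK: "1 \<le> fact m * K ^ m"
    using mult_mono[of 1 "fact m" 1 "K ^ m"] K1 by (simp add: fact_ge_1 one_le_power)
  have C1: "C \<ge> 1"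
    using mult_mono[OF fK, of 1 "C0 ^ m"] C0 K1 by (simp add: C_def one_le_power)
  show ?thesis
  proof (intro exI[of _ C] conjI allI impI C1)
    fix n :: nat and \<kappa> :: "nat \<Rightarrow> nat" and a :: "nat \<Rightarrow> complex" and H :: real
    assume n: "1 \<le> n" and aH: "\<forall>l\<le>\<delta>. norm (a l) \<le> H"
    have H: "H \<ge> 0" using aH norm_ge_zero order_trans by blast
    let ?N = "fact (n - 1) :: real"
    let ?B = "hermite_mat m \<delta> n p \<kappa> a z"
    define P where "P = (\<Sum>l\<le>\<delta>. a l * exp z ^ l)"
    define \<epsilon> where "\<epsilon> k j = exp (of_nat j * z) * hermite_num n p k 0 z - hermite_num n p k j z" for k j
    define E where "E i j = (\<Sum>l\<le>\<delta>. a l * \<epsilon> (\<kappa> j) (l + i))" for i j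
    have N: "?N \<ge> 1" by (rule fact_ge_1)
    have B: "?B $$ (i, j) = exp (of_nat i * z) * P * hermite_num n p (\<kappa> j) 0 z - E i j"
      if "i < m" "j < m" for i j
    proof -
      have "exp (of_nat (l + i) * z) = exp z ^ l * exp (of_nat i * z)" for l
        by (simp add: distrib_right exp_add exp_of_nat_mult)
      then have "exp (of_nat i * z) * P * hermite_num n p (\<kappa> j) 0 z
        = (\<Sum>l\<le>\<delta>. a l * (exp (of_nat (l + i) * z) * hermite_num n p (\<kappa> j) 0 z))"
        by (simp add: P_def sum_distrib_left sum_distrib_right mult_ac)
      then show ?thesis using that
        by (simp add: hermite_mat_def E_def \<epsilon>_def right_diff_distrib flip: sum_subtractf)
    qed
    define e where "e = C0 ^ n / ?N"
    have e0: "e \<ge> 0" using C0 by (simp add: e_def)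
    have Ebd: "norm (E i j) \<le> real (\<delta> + 1) * (H * e)" if "i < m" for i j
    proof -
      have "norm (E i j) \<le> (\<Sum>l\<le>\<delta>. H * e)"
        unfolding E_def
      proof (rule sum_norm_le)
        fix l assume l: "l \<in> {..\<delta>}"
        have "norm (\<epsilon> (\<kappa> j) (l + i)) \<le> e"
          unfolding \<epsilon>_def e_def using bd[OF n, of "l + i" "\<kappa> j"] l that by (auto simp: p)
        then show "norm (a l * \<epsilon> (\<kappa> j) (l + i)) \<le> H * e"
          using aH l H by (simp add: norm_mult mult_mono)
      qed
      then show ?thesis by simp
    qed
    \<comment> \<open>row operations that remove the rank one part from all rows but the first\<close>
    define T where "T = Matrix.mat m m (\<lambda>(i, j). if i = j then 1 else if j = 0 then - exp (of_nat i * z) else 0)"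
    have T: "T \<in> carrier_mat m m" by (simp add: T_def)
    have "diag_mat T = map (\<lambda>_. 1) [0..<m]"
      by (simp add: diag_mat_def T_def)
    moreover have "prod_list (map (\<lambda>_. 1) xs) = (1 :: complex)" for xs :: "nat list"
      by (induction xs) auto
    moreover have "Determinant.det T = prod_list (diag_mat T)"
      by (rule Determinant.det_lower_triangular[OF _ T]) (auto simp: T_def)
    ultimately have "Determinant.det T = 1" by simp
    then have detB: "Determinant.det ?B = Determinant.det (T * ?B)"
      by (simp add: det_mult[OF T hermite_mat_carrier])
    have TB: "(T * ?B) $$ (i, j) = (if i = 0 then ?B $$ (0, j) else ?B $$ (i, j) - exp (of_nat i * z) * ?B $$ (0, j))"
      if "i < m" "j < m" for i j
    proof -
      have "(T * ?B) $$ (i, j) = (\<Sum>k = 0..<m. T $$ (i, k) * ?B $$ (k, j))"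
        using that T by (simp add: scalar_prod_def hermite_mat_def)
      also have "\<dots> = (\<Sum>k = 0..<m. (if k = i then ?B $$ (i, j) else 0)
          + (if k = 0 then (if i = 0 then 0 else - exp (of_nat i * z) * ?B $$ (0, j)) else 0))"
        using that by (intro sum.cong) (auto simp: T_def)
      also have "\<dots> = ?B $$ (i, j) + (if i = 0 then 0 else - exp (of_nat i * z) * ?B $$ (0, j))"
        using that by (simp add: sum.distrib)
      finally show ?thesis by simp
    qed
    define R where "R i = (if i = 0 then norm P * (C0 ^ n * ?N ^ p) + K * (H * e) else K * (H * e))" for i :: nat
    have K': "real (\<delta> + 1) * x \<le> K * x" if "x \<ge> 0" for x
      using that by (simp add: K_def mult_right_mono)
    have "norm (Determinant.det (T * ?B)) \<le> fact m * (\<Prod>i<m. R i)"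
    proof (rule norm_det_le)
      show "T * ?B \<in> carrier_mat m m" by (rule mult_carrier_mat[OF T hermite_mat_carrier])
      fix i j assume ij: "i < m" "j < m"
      show "norm ((T * ?B) $$ (i, j)) \<le> R i"
      proof (cases "i = 0")
        case True
        have "norm (?B $$ (0, j)) \<le> norm (P * hermite_num n p (\<kappa> j) 0 z) + norm (E 0 j)"
          using B[of 0 j] ij m by (simp add: norm_triangle_ineq4)
        also have "\<dots> \<le> norm P * (C0 ^ n * ?N ^ p) + K * (H * e)"
          using bd[OF n, of 0 "\<kappa> j"] Ebd[of 0 j] m K'[of "H * e"] H e0
          by (intro add_mono) (auto simp: norm_mult intro: mult_left_mono)
        finally show ?thesis using TB[OF ij] True by (simp add: R_def)
      next
        case False
        have "(T * ?B) $$ (i, j) = exp (of_nat i * z) * E 0 j - E i j"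
          using TB[OF ij] B[OF ij] B[of 0 j] False ij m by (simp add: algebra_simps)
        also have "norm \<dots> \<le> norm (exp (of_nat i * z)) * norm (E 0 j) + norm (E i j)"
          by (rule order_trans[OF norm_triangle_ineq4]) (simp add: norm_mult)
        also have "norm (exp (of_nat i * z)) \<le> exp (real m * norm z)"
        proof -
          have "norm (exp (of_nat i * z)) \<le> exp (norm (of_nat i * z))" by (rule norm_exp)
          also have "\<dots> \<le> exp (real m * norm z)"
            using ij by (simp add: norm_mult mult_right_mono)
          finally show ?thesis .
        qed
        also have "exp (real m * norm z) * norm (E 0 j) + norm (E i j)
           \<le> exp (real m * norm z) * (real (\<delta> + 1) * (H * e)) + real (\<delta> + 1) * (H * e)"
          using ij m by (intro add_mono mult_left_mono Ebd) auto
        also have "\<dots> = K * (H * e)" by (simp add: K_def algebra_simps)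
        finally show ?thesis using False by (simp add: R_def mult_right_mono)
      qed
    qed
    also have "(\<Prod>i<m. R i) = (norm P * (C0 ^ n * ?N ^ p) + K * (H * e)) * (K * (H * e)) ^ (m - 1)"
    proof -
      obtain m' where m': "m = Suc m'" using m by (cases m) auto
      show ?thesis unfolding m' prod.lessThan_Suc_shift by (simp add: R_def)
    qed
    also have "\<dots> = norm P * (C0 ^ n * ?N ^ p) * (K * (H * e)) ^ (m - 1) + (K * (H * e)) ^ m"
      using m by (simp add: distrib_right power_eq_if)
    also have "\<dots> = (C0 ^ n) ^ m * (K ^ (m - 1) * (norm P * H ^ (m - 1) * ?N ^ \<delta>) + K ^ m * (H / ?N) ^ m)"
    proof -
      obtain m' where m': "m = Suc m'" using m by (cases m) auto
      have Np: "?N ^ p = ?N ^ \<delta> * ?N ^ m'" by (simp add: p m' power_add)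
      then have 1: "norm P * (C0 ^ n * ?N ^ p) * (K * (H * e)) ^ (m - 1)
        = (C0 ^ n) ^ m * (K ^ (m - 1) * (norm P * H ^ (m - 1) * ?N ^ \<delta>))"
        by (simp add: m' e_def power_mult_distrib power_divide Np)
      have 2: "(K * (H * e)) ^ m = (C0 ^ n) ^ m * (K ^ m * (H / ?N) ^ m)"
        by (simp add: e_def power_mult_distrib power_divide mult_ac)
      show ?thesis unfolding 1 2 by (simp add: distrib_left)
    qed
    also have "\<dots> \<le> (C0 ^ n) ^ m * (K ^ m * (norm P * H ^ (m - 1) * ?N ^ \<delta>) + K ^ m * (H / ?N) ^ m)"
    proof (intro mult_left_mono add_mono mult_right_mono)
      show "K ^ (m - 1) \<le> K ^ m" using K1 by (intro power_increasing) auto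
    qed (use H N C0 K1 in auto)
    also have "fact m * \<dots> = (fact m * K ^ m) * (C0 ^ m) ^ n * (norm P * H ^ (m - 1) * ?N ^ \<delta> + (H / ?N) ^ m)"
      by (simp add: distrib_left mult_ac flip: power_mult)
    also have "\<dots> \<le> (fact m * K ^ m) ^ n * (C0 ^ m) ^ n * (norm P * H ^ (m - 1) * ?N ^ \<delta> + (H / ?N) ^ m)"
    proof (intro mult_right_mono)
      show "fact m * K ^ m \<le> (fact m * K ^ m) ^ n" using fK n by (intro self_le_power) auto
    qed (use H C0 in auto)
    also have "\<dots> = C ^ n * (norm P * H ^ (m - 1) * ?N ^ \<delta> + (H / ?N) ^ m)"
      by (simp only: C_def power_mult_distrib)
    finally show "norm (Determinant.det ?B)
      \<le> C ^ n * (norm (\<Sum>l\<le>\<delta>. a l * exp z ^ l) * H ^ (m - 1) * ?N ^ \<delta> + (H / ?N) ^ m)"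
      by (simp add: detB P_def)
  qed
qed

section \<open>Choice of the parameter\<close>

lemma power_le_exp_times_fact:
  fixes y :: real
  assumes "y \<ge> 0"
  shows "y ^ k \<le> exp y * fact k"
proof -
  have "(\<Sum>n<Suc k. y ^ n /\<^sub>R fact n) \<le> exp y"
    unfolding exp_def by (rule sum_le_suminf[OF summable_exp_generic]) (use assms in auto)
  moreover have "y ^ k /\<^sub>R fact k \<le> (\<Sum>n<Suc k. y ^ n /\<^sub>R fact n)"
    by (rule member_le_sum) (use assms in auto)
  ultimately have "y ^ k / fact k \<le> exp y" by (simp add: divide_inverse mult.commute)
  then show ?thesis by (simp add: field_simps)
qed

text \<open>
  The right choice is the least \<open>n\<close> for which the term without \<open>x\<close> is less than \<open>1/2\<close>, that is,
  \<open>(n - 1)!\<^sup>\<mu>\<close> just exceeds \<open>2 C\<^sup>n H\<^sup>M\<close>. Then \<open>(n - 1)!\<close> is about \<open>H\<^bsup>M/\<mu>\<^esup>\<close>, so that \<open>C\<^sup>n\<close> is smaller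
  than any given power of \<open>H\<close>, up to a constant.
\<close>

lemma optimise_parameter:
  fixes C \<epsilon> :: real
  assumes C: "C \<ge> 1" and \<epsilon>: "\<epsilon> > 0" and M: "M \<ge> 1" and \<mu>: "\<mu> \<ge> 1"
  shows "\<exists>c>0. \<forall>H\<ge>1. \<forall>x\<ge>0.
    (\<forall>n\<ge>1. 1 \<le> C ^ n * (x * H ^ (M - 1) * fact (n - 1) ^ e + H ^ M / fact (n - 1) ^ \<mu>)) \<longrightarrow>
    x > c / H powr (real e * real M / real \<mu> + real M - 1 + \<epsilon>)"
proof -
  \<comment> \<open>\<open>A\<^sup>n\<close> collects all exponential factors that arise, \<open>Q\<^sup>n\<close> is the power of it to be compared with \<open>H\<^sup>M\<close>.\<close>
  define A where "A = 2 * C * (4 * C) ^ e"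
  have "2 * C * 1 \<le> A" unfolding A_def using C by (intro mult_left_mono one_le_power) auto
  then have A1: "A \<ge> 1" using C by simp
  define Q where "Q = A powr (real M / \<epsilon>)"
  have Q1: "Q \<ge> 1" using A1 \<epsilon> by (simp add: Q_def ge_one_powr_ge_zero)
  define c1 where "c1 = (C * Q) ^ 2 * exp (C * Q)"
  have c1: "c1 > 0" using C Q1 by (simp add: c1_def)
  define c' where "c' = (2 * c1) powr (\<epsilon> / real M)"
  have c': "c' > 0" using c1 by (simp add: c'_def)
  show ?thesis
  proof (intro exI[of _ "1 / (2 * c')"] conjI allI impI)
    show "1 / (2 * c') > 0" using c' by simp
    fix H x :: real
    assume H: "1 \<le> H" and x: "0 \<le> x"
      and main: "\<forall>n\<ge>1. 1 \<le> C ^ n * (x * H ^ (M - 1) * fact (n - 1) ^ e + H ^ M / fact (n - 1) ^ \<mu>)"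
    define good where "good n \<longleftrightarrow> n \<ge> 1 \<and> 2 * C ^ n * H ^ M < fact (n - 1) ^ \<mu>" for n :: nat
    \<comment> \<open>Factorials outgrow exponentials: \<open>(2 C)\<^sup>k \<le> e\<^bsup>2 C\<^esup> k!\<close> leaves a spare factor \<open>2\<^sup>k\<close>.\<close>
    have "\<exists>n. good n"
    proof -
      obtain k :: nat where k: "2 * C * H ^ M * exp (2 * C) < 2 ^ k"
        using real_arch_pow[of 2] by auto
      have "2 * C ^ Suc k * H ^ M * exp (2 * C) = C ^ k * (2 * C * H ^ M * exp (2 * C))" by simp
      also have "\<dots> < C ^ k * 2 ^ k" using k C by (intro mult_strict_left_mono) auto
      also have "\<dots> = (2 * C) ^ k" by (simp add: power_mult_distrib)
      also have "\<dots> \<le> exp (2 * C) * fact k" using C by (intro power_le_exp_times_fact) auto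
      finally have "2 * C ^ Suc k * H ^ M < fact k" by (simp add: mult.commute)
      also have "(fact k :: real) \<le> fact k ^ \<mu>"
        using \<mu> fact_ge_1[of k, where ?'a = real] by (intro self_le_power) auto
      finally have "good (Suc k)" by (simp add: good_def)
      then show ?thesis by blast
    qed
    define n where "n = (LEAST n. good n)"
    have n: "good n" and least: "\<And>n'. n' < n \<Longrightarrow> \<not> good n'"
      using \<open>\<exists>n. good n\<close> unfolding n_def by (auto intro: LeastI dest: not_less_Least)
    have "n \<noteq> 1"
    proof
      assume "n = 1"
      then have "2 * C * H ^ M < 1" using n by (simp add: good_def)
      moreover have "1 * 1 \<le> C * H ^ M" using C H by (intro mult_mono one_le_power) auto
      ultimately show False by simp
    qed
    then have n2: "n \<ge> 2" using n by (simp add: good_def)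
    let ?N = "fact (n - 1) :: real" and ?N' = "fact (n - 2) :: real"
    have N'1: "?N' \<ge> 1" by (rule fact_ge_1)
    have prev: "?N' ^ \<mu> \<le> 2 * C ^ n * H ^ M"
    proof -
      have "\<not> good (n - 1)" by (rule least) (use n2 in simp)
      then have "?N' ^ \<mu> \<le> 2 * C ^ (n - 1) * H ^ M"
        using n2 by (simp add: good_def not_less numeral_2_eq_2)
      also have "\<dots> \<le> 2 * C ^ n * H ^ M"
        using C H by (intro mult_right_mono mult_left_mono power_increasing) auto
      finally show ?thesis .
    qed
    \<comment> \<open>the exponential factors cost only \<open>H^\<epsilon>\<close>\<close>
    have An: "A ^ n \<le> c' * H powr \<epsilon>"
    proof -
      have "(C * Q) ^ n = (C * Q) ^ 2 * (C * Q) ^ (n - 2)"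
        using n2 by (metis power_add le_add_diff_inverse)
      also have "\<dots> \<le> (C * Q) ^ 2 * (exp (C * Q) * ?N')"
        using C Q1 by (intro mult_left_mono power_le_exp_times_fact) auto
      also have "\<dots> = c1 * ?N'" by (simp add: c1_def)
      also have "\<dots> \<le> c1 * ?N' ^ \<mu>" using c1 \<mu> N'1 by (intro mult_left_mono self_le_power) auto
      also have "\<dots> \<le> c1 * (2 * C ^ n * H ^ M)" using c1 by (intro mult_left_mono prev) auto
      finally have "C ^ n * Q ^ n \<le> C ^ n * (2 * c1 * H ^ M)"
        by (simp add: power_mult_distrib mult_ac)
      then have Qn: "Q ^ n \<le> 2 * c1 * H ^ M" using C by simp
      have "A ^ n = (Q ^ n) powr (\<epsilon> / real M)"
      proof -
        have "(Q ^ n) powr (\<epsilon> / real M) = A powr (real n)"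
          using Q1 A1 \<epsilon> M by (simp add: Q_def powr_powr flip: powr_realpow)
        then show ?thesis using A1 by (simp add: powr_realpow)
      qed
      also have "\<dots> \<le> (2 * c1 * H ^ M) powr (\<epsilon> / real M)"
        using Qn Q1 \<epsilon> by (intro powr_mono2) auto
      also have "\<dots> = c' * (H ^ M) powr (\<epsilon> / real M)"
        using c1 H by (simp add: c'_def powr_mult)
      also have "(H ^ M) powr (\<epsilon> / real M) = H powr \<epsilon>"
        using H M by (simp add: powr_powr flip: powr_realpow)
      finally show ?thesis .
    qed
    have N': "?N' \<le> 2 * C ^ n * H powr (real M / real \<mu>)"
    proof -
      have "?N' = (?N' ^ \<mu>) powr (1 / real \<mu>)"
        using \<mu> N'1 by (simp add: powr_powr flip: powr_realpow)
      also have "\<dots> \<le> (2 * C ^ n * H ^ M) powr (1 / real \<mu>)"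
        using prev by (intro powr_mono2) auto
      also have "\<dots> = (2 * C ^ n) powr (1 / real \<mu>) * (H ^ M) powr (1 / real \<mu>)"
        using C H by (simp add: powr_mult)
      also have "(H ^ M) powr (1 / real \<mu>) = H powr (real M / real \<mu>)"
        using H by (simp add: powr_powr flip: powr_realpow)
      also have "(2 * C ^ n) powr (1 / real \<mu>) \<le> (2 * C ^ n) powr 1"
      proof (rule powr_mono)
        have "1 \<le> C ^ n" using C by (rule one_le_power)
        then show "1 \<le> 2 * C ^ n" by simp
      qed (use \<mu> in auto)
      finally show ?thesis using C by (simp add: mult_right_mono)
    qed
    have N: "?N \<le> (4 * C) ^ n * H powr (real M / real \<mu>)"
    proof -
      have "?N = real (n - 1) * ?N'"
        using n2 by (simp add: fact_reduce numeral_2_eq_2)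
      also have "\<dots> \<le> 2 ^ (n - 1) * (2 * C ^ n * H powr (real M / real \<mu>))"
      proof (intro mult_mono N')
        show "real (n - 1) \<le> 2 ^ (n - 1)" by (rule less_imp_le[OF of_nat_less_two_power])
      qed auto
      also have "\<dots> = 2 ^ n * C ^ n * H powr (real M / real \<mu>)"
        using n2 by (cases n) auto
      also have "\<dots> = (2 * C) ^ n * H powr (real M / real \<mu>)" by (simp add: power_mult_distrib)
      also have "\<dots> \<le> (4 * C) ^ n * H powr (real M / real \<mu>)"
        using C by (intro mult_right_mono power_mono) auto
      finally show ?thesis .
    qed
    let ?s = "real e * real M / real \<mu> + real M - 1"
    have step: "2 * C ^ n * (H ^ (M - 1) * ?N ^ e) \<le> A ^ n * H powr ?s"
    proof -
      have Ne: "?N ^ e \<le> ((4 * C) ^ e) ^ n * H powr (real e * real M / real \<mu>)"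
      proof -
        have "?N ^ e \<le> ((4 * C) ^ n * H powr (real M / real \<mu>)) ^ e"
          by (intro power_mono N) auto
        also have "\<dots> = ((4 * C) ^ e) ^ n * (H powr (real M / real \<mu>)) ^ e"
          by (simp add: power_mult_distrib mult.commute flip: power_mult)
        also have "(H powr (real M / real \<mu>)) ^ e = H powr (real e * real M / real \<mu>)"
          using H by (simp add: powr_powr mult.commute flip: powr_realpow)
        finally show ?thesis .
      qed
      have HM: "H ^ (M - 1) = H powr (real M - 1)"
        using H M by (simp add: of_nat_diff flip: powr_realpow)
      have "2 * C ^ n * (H ^ (M - 1) * ?N ^ e)
        \<le> 2 * C ^ n * (H powr (real M - 1) * (((4 * C) ^ e) ^ n * H powr (real e * real M / real \<mu>)))"
        unfolding HM
        by (intro mult_left_mono Ne) (use C in auto)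
      also have "\<dots> = 2 * C ^ n * ((4 * C) ^ e) ^ n * H powr ?s"
        by (simp add: powr_add[symmetric] algebra_simps)
      also have "\<dots> \<le> 2 ^ n * C ^ n * ((4 * C) ^ e) ^ n * H powr ?s"
        using C n2 self_le_power[of 2 n] by (intro mult_right_mono) auto
      also have "\<dots> = A ^ n * H powr ?s" by (simp add: A_def power_mult_distrib)
      finally show ?thesis .
    qed
    have half: "C ^ n * (H ^ M / ?N ^ \<mu>) < 1 / 2"
      using n by (simp add: good_def field_simps)
    have "1 \<le> C ^ n * (x * H ^ (M - 1) * ?N ^ e + H ^ M / ?N ^ \<mu>)"
      using main n2 by simp
    also have "\<dots> = x * (C ^ n * (H ^ (M - 1) * ?N ^ e)) + C ^ n * (H ^ M / ?N ^ \<mu>)"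
      by (simp add: algebra_simps)
    finally have "1 < 2 * (x * (C ^ n * (H ^ (M - 1) * ?N ^ e)))" using half by linarith
    also have "\<dots> = x * (2 * C ^ n * (H ^ (M - 1) * ?N ^ e))" by simp
    also have "\<dots> \<le> x * (A ^ n * H powr ?s)" using x by (intro mult_left_mono step)
    also have "\<dots> \<le> x * (c' * H powr \<epsilon> * H powr ?s)"
      using x by (intro mult_left_mono mult_right_mono An) auto
    also have "\<dots> = x * (c' * H powr (?s + \<epsilon>))" by (simp add: powr_add mult_ac)
    finally have "1 < x * (c' * H powr (?s + \<epsilon>))" .
    then have "1 / (c' * H powr (?s + \<epsilon>)) < x" using c' H by (simp add: field_simps)
    moreover have "1 / (2 * c') / H powr (?s + \<epsilon>) \<le> 1 / (c' * H powr (?s + \<epsilon>))"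
      using c' H by (simp add: field_simps)
    ultimately show "1 / (2 * c') / H powr (?s + \<epsilon>) < x" by simp
  qed
qed

section \<open>The transcendence measure\<close>

text \<open>
  The product of \<open>\<Delta> = det hermite_mat\<close>, scaled to be an algebraic integer, over all embeddings of \<open>\<rat>(\<theta>)\<close> is at
  least \<open>1\<close> in absolute value. The factor \<open>\<Delta>\<close> itself contributes the first bracket, and each of
  the at most \<open>d - 1\<close> other factors contributes at most \<open>H\<^sup>m N\<^sup>\<delta>\<close>, up to \<open>C\<^sup>n\<close>.
\<close>

lemma liouville_inequality:
  fixes f g :: "rat poly"
  assumes f: "Factorial_Ring.irreducible f" "rat_eval \<theta> f = 0" "Polynomial.degree f \<le> d"
    and \<alpha>: "\<alpha> = rat_eval \<theta> g" "\<alpha> \<noteq> 0" "algebraic \<alpha>"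
    and d: "d \<ge> 1" and m: "m \<ge> 1"
  shows "\<exists>C\<ge>1. \<forall>n\<ge>1. \<forall>H\<ge>1. \<forall>a.
    (\<forall>l. a l \<in> rat_adjoin \<theta> \<and> algebraic_int (a l) \<and> (a l \<noteq> 0 \<longrightarrow> house (a l) \<le> H)) \<and>
    (\<exists>l\<le>\<delta>. a l \<noteq> 0) \<longrightarrow>
    1 \<le> C ^ n * ((norm (\<Sum>l\<le>\<delta>. a l * exp \<alpha> ^ l) * H ^ (m - 1) * fact (n - 1) ^ \<delta> + (H / fact (n - 1)) ^ m)
           * (H ^ m * fact (n - 1) ^ \<delta>) ^ (d - 1))"
proof -
  define p where "p = \<delta> + m - 1"
  define S where "S = {t. rat_eval t f = 0}"
  have f0: "map_poly of_rat f \<noteq> (0 :: complex poly)" using f(1) by auto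
  have S: "finite S" "\<theta> \<in> S" unfolding S_def using f poly_roots_finite[OF f0] by auto
  obtain D :: nat where D: "D > 0" "algebraic_int (of_nat D * \<alpha>)"
    using algebraic_clear_denominator[OF \<alpha>(3)] by blast
  define bound where "bound t C \<longleftrightarrow> (\<forall>n\<ge>1. \<forall>\<kappa> a H. (\<forall>l\<le>\<delta>. norm (a l) \<le> H) \<longrightarrow>
    norm (Determinant.det (hermite_mat m \<delta> n p \<kappa> a (rat_eval t g)))
      \<le> C ^ n * (norm (\<Sum>l\<le>\<delta>. a l * exp (rat_eval t g) ^ l) * H ^ (m - 1) * fact (n - 1) ^ \<delta>
          + (H / fact (n - 1)) ^ m))" for t C
  have "\<exists>C\<ge>1. bound t C" for t
    unfolding bound_def by (rule norm_det_hermite_mat_le[OF m p_def])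
  then obtain Ct where Ct: "\<And>t. Ct t \<ge> 1" "\<And>t. bound t (Ct t)" by metis
  \<comment> \<open>\<open>(E t - 1) H\<close> bounds the conjugate polynomial at \<open>e\<^sup>z\<close>; the extra \<open>1\<close> absorbs the second summand of the determinant bound.\<close>
  define E where "E t = real (\<delta> + 1) * exp (real \<delta> * norm (rat_eval t g)) + 1" for t
  have E1: "E t \<ge> 1" for t by (simp add: E_def)
  define C1 where "C1 = (\<Sum>t\<in>S. Ct t * E t)"
  have CE1: "1 * 1 \<le> Ct t * E t" for t
    using Ct(1)[of t] E1[of t] by (intro mult_mono) auto
  have C1: "Ct t * E t \<le> C1" if "t \<in> S" for t
  proof -
    have "0 \<le> Ct u * E u" for u using CE1[of u] by simp
    then show ?thesis unfolding C1_def using S that by (intro member_le_sum) auto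
  qed
  have C11: "C1 \<ge> 1" using C1[OF S(2)] CE1[of \<theta>] by simp
  define D' where "D' = real D ^ ((p + 1) * m)"
  have D'1: "D' \<ge> 1" using D by (simp add: D'_def)
  define B where "B = D' * C1"
  have B1: "B \<ge> 1" using mult_mono[of 1 D' 1 C1] D'1 C11 by (simp add: B_def)
  show ?thesis
  proof (intro exI[of _ "B ^ d"] conjI allI impI)
    show "1 \<le> B ^ d" using B1 by (rule one_le_power)
    fix n :: nat and H :: real and a :: "nat \<Rightarrow> complex"
    assume n: "1 \<le> n" and H: "1 \<le> H"
      and a: "(\<forall>l. a l \<in> rat_adjoin \<theta> \<and> algebraic_int (a l) \<and> (a l \<noteq> 0 \<longrightarrow> house (a l) \<le> H)) \<and>
        (\<exists>l\<le>\<delta>. a l \<noteq> 0)"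
    let ?N = "fact (n - 1) :: real"
    have N: "?N \<ge> 1" by (rule fact_ge_1)
    \<comment> \<open>Representing \<open>0\<close> by \<open>0\<close> makes the conjugates of vanishing coefficients vanish, whatever the house of \<open>0\<close>.\<close>
    have "\<exists>h. a l = rat_eval \<theta> h \<and> (a l = 0 \<longrightarrow> h = 0)" for l
      using a by (cases "a l = 0") (auto simp: rat_adjoin_def)
    then obtain h where h: "\<And>l. a l = rat_eval \<theta> (h l)" "\<And>l. a l = 0 \<Longrightarrow> h l = 0" by metis
    have hH: "norm (rat_eval t (h l)) \<le> H" if "t \<in> S" for t l
    proof (cases "a l = 0")
      case True
      then show ?thesis using h(2) H by simp
    next
      case False
      have "norm (rat_eval t (h l)) \<le> house (rat_eval \<theta> (h l))"
        by (rule house_ge_conjugate_value[OF f(1,2)]) (use that a h(1) in \<open>auto simp: S_def\<close>)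
      then show ?thesis using a False by (metis h(1) order_trans)
    qed
    obtain \<kappa> where \<kappa>: "Determinant.det (hermite_mat m \<delta> n p \<kappa> a \<alpha>) \<noteq> 0"
      using exists_det_hermite_mat_nonzero[OF \<alpha>(2) n m p_def] a by blast
    define G where "G = of_nat (D ^ ((p + 1) * n * m)) * Determinant.det (hermite_mat m \<delta> n p \<kappa> h g)"
    have G: "rat_eval t G = of_nat D ^ ((p + 1) * n * m)
        * Determinant.det (hermite_mat m \<delta> n p \<kappa> (\<lambda>l. rat_eval t (h l)) (rat_eval t g))" for t
    proof -
      interpret comm_ring_hom "rat_eval t" by (rule rat_eval_hom)
      show ?thesis unfolding G_def hom_mult hom_of_nat hom_det_hermite_mat by simp
    qed
    have G\<theta>: "rat_eval \<theta> G = of_nat D ^ ((p + 1) * n * m) * Determinant.det (hermite_mat m \<delta> n p \<kappa> a \<alpha>)"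
      unfolding G by (simp add: h(1)[symmetric] \<alpha>(1)[symmetric])
    have normG: "norm (rat_eval t G) \<le> B ^ n * (norm (\<Sum>l\<le>\<delta>. rat_eval t (h l) * exp (rat_eval t g) ^ l) * H ^ (m - 1) * ?N ^ \<delta> + (H / ?N) ^ m)"
      and normG': "norm (rat_eval t G) \<le> B ^ n * (H ^ m * ?N ^ \<delta>)" if t: "t \<in> S" for t
    proof -
      define w where "w = norm (\<Sum>l\<le>\<delta>. rat_eval t (h l) * exp (rat_eval t g) ^ l)"
      have w: "w \<le> (E t - 1) * H"
      proof -
        have "w \<le> (\<Sum>l\<le>\<delta>. H * exp (real \<delta> * norm (rat_eval t g)))"
          unfolding w_def
        proof (rule sum_norm_le)
          fix l assume l: "l \<in> {..\<delta>}"
          have "norm (exp (rat_eval t g) ^ l) \<le> exp (norm (of_nat l * rat_eval t g))"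
            by (simp only: exp_of_nat_mult[symmetric] norm_exp)
          also have "\<dots> \<le> exp (real \<delta> * norm (rat_eval t g))"
            using l by (simp add: norm_mult mult_right_mono)
          finally show "norm (rat_eval t (h l) * exp (rat_eval t g) ^ l) \<le> H * exp (real \<delta> * norm (rat_eval t g))"
            unfolding norm_mult using hH[OF t] H by (intro mult_mono) auto
        qed
        then show ?thesis by (simp add: E_def mult_ac)
      qed
      have T: "0 \<le> w * H ^ (m - 1) * ?N ^ \<delta> + (H / ?N) ^ m" using H N by (simp add: w_def)
      have "norm (rat_eval t G) \<le> real D ^ ((p + 1) * n * m) * (Ct t ^ n * (w * H ^ (m - 1) * ?N ^ \<delta> + (H / ?N) ^ m))"
        unfolding G norm_mult w_def using Ct(2)[of t] n hH[OF t]
        by (intro mult_mono) (auto simp: bound_def norm_power)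
      also have "real D ^ ((p + 1) * n * m) = D' ^ n"
        by (simp add: D'_def algebra_simps flip: power_mult)
      finally have *: "norm (rat_eval t G) \<le> (D' * Ct t) ^ n * (w * H ^ (m - 1) * ?N ^ \<delta> + (H / ?N) ^ m)"
        by (simp add: power_mult_distrib mult_ac)
      have "Ct t * 1 \<le> Ct t * E t" using Ct(1)[of t] E1[of t] by (intro mult_left_mono) auto
      then have "D' * Ct t \<le> B" unfolding B_def using C1[OF t] D'1 by (intro mult_left_mono) auto
      then have "(D' * Ct t) ^ n \<le> B ^ n" using D'1 Ct(1)[of t] by (intro power_mono) auto
      from order_trans[OF * mult_right_mono[OF this T]]
      show "norm (rat_eval t G) \<le> B ^ n * (norm (\<Sum>l\<le>\<delta>. rat_eval t (h l) * exp (rat_eval t g) ^ l) * H ^ (m - 1) * ?N ^ \<delta> + (H / ?N) ^ m)"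
        unfolding w_def .
      have "w * H ^ (m - 1) * ?N ^ \<delta> + (H / ?N) ^ m \<le> (E t - 1) * H * H ^ (m - 1) * ?N ^ \<delta> + H ^ m * ?N ^ \<delta>"
      proof (intro add_mono mult_right_mono w)
        have "(H / ?N) ^ m \<le> H ^ m" using H N by (intro power_mono) (auto simp: field_simps)
        also have "H ^ m * 1 \<le> H ^ m * ?N ^ \<delta>" using H N by (intro mult_left_mono one_le_power) auto
        finally show "(H / ?N) ^ m \<le> H ^ m * ?N ^ \<delta>" by simp
      qed (use H in auto)
      also have "\<dots> = E t * (H ^ m * ?N ^ \<delta>)"
        using m by (cases m) (auto simp: algebra_simps)
      also have "\<dots> \<le> E t ^ n * (H ^ m * ?N ^ \<delta>)"
        using E1[of t] n H by (intro mult_right_mono self_le_power) auto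
      finally have "norm (rat_eval t G) \<le> (D' * Ct t) ^ n * (E t ^ n * (H ^ m * ?N ^ \<delta>))"
        using * D'1 Ct(1)[of t] by (elim order_trans) (intro mult_left_mono; simp)
      also have "\<dots> = (D' * (Ct t * E t)) ^ n * (H ^ m * ?N ^ \<delta>)" by (simp add: power_mult_distrib mult_ac)
      also have "\<dots> \<le> B ^ n * (H ^ m * ?N ^ \<delta>)"
        unfolding B_def using C1[OF t] D'1 CE1[of t] H
        by (intro mult_right_mono power_mono mult_left_mono) auto
      finally show "norm (rat_eval t G) \<le> B ^ n * (H ^ m * ?N ^ \<delta>)" .
    qed
    define U where "U = norm (\<Sum>l\<le>\<delta>. a l * exp \<alpha> ^ l) * H ^ (m - 1) * ?N ^ \<delta> + (H / ?N) ^ m"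
    define Y where "Y = H ^ m * ?N ^ \<delta>"
    have "1 * 1 \<le> Y" unfolding Y_def using H N by (intro mult_mono one_le_power) auto
    then have Y1: "Y \<ge> 1" by simp
    have BY: "1 \<le> B ^ n * Y" using mult_mono[of 1 "B ^ n" 1 Y] Y1 B1 by (simp add: one_le_power)
    have U0: "U \<ge> 0" using H N by (simp add: U_def)
    have intG: "algebraic_int (rat_eval \<theta> G)"
      unfolding G\<theta> by (rule algebraic_int_det_hermite_mat[OF D(2)]) (use a in blast)
    have "rat_eval \<theta> G \<noteq> 0" unfolding G\<theta> using D \<kappa> by simp
    then have "1 \<le> (\<Prod>t\<in>#proots (map_poly of_rat f). norm (rat_eval t G))"
      by (rule prod_conjugate_values_ge_1[OF f(1,2) intG])
    moreover obtain R where R: "proots (map_poly of_rat f) = add_mset \<theta> R"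
      using S(2) f0 by (metis mem_Collect_eq multi_member_split set_count_proots S_def)
    ultimately have "1 \<le> norm (rat_eval \<theta> G) * (\<Prod>t\<in>#R. norm (rat_eval t G))" by simp
    also have "\<dots> \<le> (B ^ n * U) * (B ^ n * Y) ^ (d - 1)"
    proof (intro mult_mono)
      show "norm (rat_eval \<theta> G) \<le> B ^ n * U"
        using normG[OF S(2)] unfolding U_def by (simp add: h(1)[symmetric] \<alpha>(1)[symmetric])
      have RS: "t \<in> S" if "t \<in># R" for t
      proof -
        have "t \<in># proots (map_poly of_rat f)" using that by (simp add: R)
        then show ?thesis using f0 by (simp add: S_def)
      qed
      have nonneg: "0 \<le> (\<Prod>t\<in>#R'. norm (rat_eval t G))" for R'
        by (induction R') auto
      have "(\<Prod>t\<in>#R'. norm (rat_eval t G)) \<le> (B ^ n * Y) ^ size R'" if "R' \<subseteq># R" for R'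
        using that
      proof (induction R')
        case (add t R')
        then have t: "t \<in> S" "R' \<subseteq># R"
          using RS by (auto dest: mset_subset_eq_insertD intro: subset_mset.less_imp_le)
        have "norm (rat_eval t G) \<le> B ^ n * Y" using normG'[OF t(1)] by (simp add: Y_def)
        then show ?case using add.IH[OF t(2)] nonneg[of R'] BY by (auto intro!: mult_mono)
      qed simp
      then have "(\<Prod>t\<in>#R. norm (rat_eval t G)) \<le> (B ^ n * Y) ^ size R" by simp
      also have "\<dots> \<le> (B ^ n * Y) ^ (d - 1)"
      proof (rule power_increasing[OF _ BY])
        have "size (proots (map_poly of_rat f :: complex poly)) = Polynomial.degree f"
          by (simp add: size_proots_complex degree_map_poly)
        then show "size R \<le> d - 1" using f(3) by (simp add: R)
      qed
      finally show "(\<Prod>t\<in>#R. norm (rat_eval t G)) \<le> (B ^ n * Y) ^ (d - 1)" .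
    next
      show "0 \<le> (\<Prod>t\<in>#R. norm (rat_eval t G))" by (induction R) auto
    qed (use U0 B1 in auto)
    also have "\<dots> = (B ^ d) ^ n * (U * Y ^ (d - 1))"
    proof -
      obtain d' where "d = Suc d'" using d by (cases d) auto
      then show ?thesis by (simp add: power_mult_distrib mult_ac flip: power_mult power_add)
    qed
    finally show "1 \<le> (B ^ d) ^ n * ((norm (\<Sum>l\<le>\<delta>. a l * exp \<alpha> ^ l) * H ^ (m - 1) * ?N ^ \<delta> + (H / ?N) ^ m) * (H ^ m * ?N ^ \<delta>) ^ (d - 1))"
      unfolding U_def Y_def .
  qed
qed

text \<open>
  For \<open>d \<ge> 2\<close> the square root is at least \<open>1\<close>, which compensates the \<open>- 1\<close> in the definition.
\<close>

lemma lam_ge: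
  assumes "d \<ge> 1" "\<delta> \<ge> 1"
  shows "\<delta> * d \<le> lam d \<delta>"
proof (cases "d = 1")
  case False
  then have d: "d \<ge> 2" using assms by simp
  have "1 \<le> (real d)\<^sup>2 - real d"
  proof -
    have "2 * 1 \<le> real d * (real d - 1)" using d by (intro mult_mono) auto
    then show ?thesis by (simp add: power2_eq_square algebra_simps)
  qed
  then have "1 * 1 \<le> real \<delta> * sqrt ((real d)\<^sup>2 - real d)"
    using assms by (intro mult_mono) auto
  then have "1 \<le> \<lfloor>real \<delta> * sqrt ((real d)\<^sup>2 - real d)\<rfloor>" by (simp add: le_floor_iff)
  then have "1 \<le> nat \<lfloor>real \<delta> * sqrt ((real d)\<^sup>2 - real d)\<rfloor>" by linarith
  then have "\<delta> * d \<le> psi_p1 d \<delta>" unfolding psi_p1_def by linarith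
  then show ?thesis using False by (simp add: lam_def psi_p2_def)
qed (simp add: lam_def)

text \<open>
  The parameter \<open>p\<close> is free here: its choice only influences the exponent.
\<close>

theorem transcendence_measure:
  fixes K :: "complex set" and \<alpha> :: complex and d \<delta> p :: nat and \<epsilon> :: real
  assumes \<alpha>: "algebraic \<alpha>" "\<alpha> \<noteq> 0"
    and deg: "has_degree_over_rat (adjoin K \<alpha>) d" and d: "d \<ge> 1"
    and \<epsilon>: "\<epsilon> > 0" and \<delta>: "\<delta> \<ge> 1" and p: "p \<ge> \<delta> * d"
  shows "\<exists>c::real. c > 0 \<and>
    (\<forall>H::real. H \<ge> 1 \<longrightarrow>
      (\<forall>P::complex poly.
         (\<forall>j. Polynomial.coeff P j \<in> ring_of_integers K) \<and> P \<noteq> 0 \<and>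
         Polynomial.degree P \<le> \<delta> \<and> height P \<le> H \<longrightarrow>
         norm (poly P (exp \<alpha>)) > c / H powr (psi d \<delta> p + \<epsilon>)))"
proof -
  obtain \<theta> f where f: "Factorial_Ring.irreducible f" "rat_eval \<theta> f = 0" "Polynomial.degree f \<le> d"
    and K: "K \<subseteq> rat_adjoin \<theta>" "\<alpha> \<in> rat_adjoin \<theta>"
    using adjoin_primitive_element[OF deg] by blast
  obtain g where g: "\<alpha> = rat_eval \<theta> g" using K(2) unfolding rat_adjoin_def by blast
  define m where "m = p + 1 - \<delta>"
  define \<mu> where "\<mu> = p + 1 - \<delta> * d"
  have "\<delta> \<le> p" using order_trans[OF mult_le_mono2[OF d, of \<delta>] p] by simp
  then have m: "m \<ge> 1" "real m = real p - real \<delta> + 1" by (auto simp: m_def)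
  have \<mu>: "\<mu> \<ge> 1" "real \<mu> = real p - real \<delta> * real d + 1"
    using p by (auto simp: \<mu>_def of_nat_diff)
  have m\<mu>: "m = \<mu> + \<delta> * (d - 1)"
  proof -
    have "\<delta> * d = \<delta> + \<delta> * (d - 1)" using d by (cases d) auto
    then show ?thesis using p by (simp add: m_def \<mu>_def)
  qed
  obtain C where C: "C \<ge> 1" and liouville: "\<And>n H a. 1 \<le> n \<Longrightarrow> 1 \<le> H \<Longrightarrow>
    (\<forall>l. a l \<in> rat_adjoin \<theta> \<and> algebraic_int (a l) \<and> (a l \<noteq> 0 \<longrightarrow> house (a l) \<le> H)) \<and>
    (\<exists>l\<le>\<delta>. a l \<noteq> 0) \<Longrightarrow>
    1 \<le> C ^ n * ((norm (\<Sum>l\<le>\<delta>. a l * exp \<alpha> ^ l) * H ^ (m - 1) * fact (n - 1) ^ \<delta> + (H / fact (n - 1)) ^ m)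
           * (H ^ m * fact (n - 1) ^ \<delta>) ^ (d - 1))"
    using liouville_inequality[OF f g \<alpha>(2,1) d m(1), of \<delta>] by blast
  have "m * d \<ge> 1" using m d by simp
  then obtain c where c: "c > 0" and opt: "\<And>H x. 1 \<le> H \<Longrightarrow> 0 \<le> x \<Longrightarrow>
    (\<forall>n\<ge>1. 1 \<le> C ^ n * (x * H ^ (m * d - 1) * fact (n - 1) ^ (\<delta> * d) + H ^ (m * d) / fact (n - 1) ^ \<mu>)) \<Longrightarrow>
    x > c / H powr (real (\<delta> * d) * real (m * d) / real \<mu> + real (m * d) - 1 + \<epsilon>)"
    using optimise_parameter[OF C \<epsilon> _ \<mu>(1), of "m * d" "\<delta> * d"] by blast
  have psi: "real (\<delta> * d) * real (m * d) / real \<mu> + real (m * d) - 1 = psi d \<delta> p"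
    by (simp add: psi_def m(2) \<mu>(2) power2_eq_square mult_ac)
  show ?thesis
  proof (intro exI[of _ c] conjI allI impI c)
    fix H :: real and P :: "complex poly"
    assume H: "1 \<le> H"
      and P: "(\<forall>j. Polynomial.coeff P j \<in> ring_of_integers K) \<and> P \<noteq> 0 \<and>
         Polynomial.degree P \<le> \<delta> \<and> height P \<le> H"
    define a where "a l = Polynomial.coeff P l" for l
    have a: "(\<forall>l. a l \<in> rat_adjoin \<theta> \<and> algebraic_int (a l) \<and> (a l \<noteq> 0 \<longrightarrow> house (a l) \<le> H)) \<and>
      (\<exists>l\<le>\<delta>. a l \<noteq> 0)"
    proof (intro conjI allI impI)
      fix l
      show "a l \<in> rat_adjoin \<theta>" "algebraic_int (a l)"
        using P K(1) by (auto simp: a_def ring_of_integers_def)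
      assume "a l \<noteq> 0"
      then have "l \<le> Polynomial.degree P" unfolding a_def by (rule le_degree)
      then have "house (a l) \<le> height P" unfolding height_def a_def by (intro Max_ge) auto
      then show "house (a l) \<le> H" using P by linarith
    next
      show "\<exists>l\<le>\<delta>. a l \<noteq> 0"
        using P by (intro exI[of _ "Polynomial.degree P"]) (simp add: a_def)
    qed
    have val: "(\<Sum>l\<le>\<delta>. a l * exp \<alpha> ^ l) = poly P (exp \<alpha>)"
      unfolding poly_altdef a_def
      by (rule sum.mono_neutral_right) (use P in \<open>auto simp: coeff_eq_0\<close>)
    let ?x = "norm (poly P (exp \<alpha>))"
    have "1 \<le> C ^ n * (?x * H ^ (m * d - 1) * fact (n - 1) ^ (\<delta> * d) + H ^ (m * d) / fact (n - 1) ^ \<mu>)"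
      if n: "n \<ge> 1" for n
    proof -
      let ?N = "fact (n - 1) :: real"
      obtain d' where d': "d = Suc d'" using d by (cases d) auto
      obtain m' where m': "m = Suc m'" using m by (cases m) auto
      have "(?x * H ^ (m - 1) * ?N ^ \<delta> + (H / ?N) ^ m) * (H ^ m * ?N ^ \<delta>) ^ (d - 1)
        = ?x * (H ^ (m - 1) * H ^ (m * (d - 1))) * (?N ^ \<delta> * ?N ^ (\<delta> * (d - 1)))
          + (H ^ m * H ^ (m * (d - 1))) * (?N ^ (\<delta> * (d - 1)) / ?N ^ m)"
        by (simp add: algebra_simps power_mult_distrib power_divide flip: power_mult)
      also have "H ^ (m - 1) * H ^ (m * (d - 1)) = H ^ (m * d - 1)"
        by (simp add: d' m' flip: power_add)
      also have "?N ^ \<delta> * ?N ^ (\<delta> * (d - 1)) = ?N ^ (\<delta> * d)"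
        by (simp add: d' flip: power_add)
      also have "H ^ m * H ^ (m * (d - 1)) = H ^ (m * d)"
        by (simp add: d' flip: power_add)
      also have "?N ^ (\<delta> * (d - 1)) / ?N ^ m = 1 / ?N ^ \<mu>"
        by (subst m\<mu>) (simp add: power_add)
      finally show ?thesis using liouville[OF n H a] unfolding val by simp
    qed
    then show "norm (poly P (exp \<alpha>)) > c / H powr (psi d \<delta> p + \<epsilon>)"
      using opt[OF H, of ?x] unfolding psi by simp
  qed
qed

theorem theorem1:
  fixes K :: "complex set" and \<alpha> :: complex and d \<delta> :: nat and \<epsilon> :: real
  assumes "number_field K"
    and "algebraic \<alpha>" and "\<alpha> \<noteq> 0"
    and "has_degree_over_rat (adjoin K \<alpha>) d" and "d \<ge> 1"
    and "\<epsilon> > 0" and "\<delta> \<ge> 1"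
  shows "\<exists>c::real. c > 0 \<and>
    (\<forall>H::real. H \<ge> 1 \<longrightarrow>
      (\<forall>P::complex poly.
         (\<forall>j. Polynomial.coeff P j \<in> ring_of_integers K) \<and> P \<noteq> 0 \<and>
         Polynomial.degree P \<le> \<delta> \<and> height P \<le> H \<longrightarrow>
         norm (poly P (exp \<alpha>)) > c / H powr (psi d \<delta> (lam d \<delta>) + \<epsilon>)))"
  using transcendence_measure[OF assms(2-7) lam_ge[OF assms(5,7)]] .

end
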